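(* Let $n\ge1$ and let $\mathcal{L}(n)$ be the set of all plane overpartitions (the empty one included) whose largest entry is at most $n$. Then $$\sum_{\Pi \in \mathcal{L}(n)}a^{o(\Pi)}q^{|\Pi|}=\prod_{j=1}^n \frac{\prod_{i=0}^n(1+aq^{i+j})}{\prod_{i=1}^{j}(1-q^{i+j-1})(1-a^2q^{i+j})}.$$
   Context: A plane overpartition is a filling of the Ferrers diagram of some partition with positive integers, weakly decreasing along each row (left to right) and each column (top to bottom), in which some entries are overlined subject to: (1) in each row, only the last (rightmost) occurrence of a given integer may be overlined; (2) in each column, the first (topmost) occurrence of a given integer may be overlined or not, and all other occurrences of that integer in the column are overlined. The value of an entry ignores the overline. $|\Pi|$ is the sum of all entries and $o(\Pi)$ the number of overlined entries. *)

theory Defs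
  imports "HOL-Analysis.Analysis" "HOL-Computational_Algebra.Formal_Power_Series"
begin

definition is_partition :: "nat list \<Rightarrow> bool" where
  "is_partition lam \<longleftrightarrow> sorted_wrt (\<ge>) lam \<and> (\<forall>p\<in>set lam. 0 < p)"

text \<open>Cells are pairs (row, column), both counted from 0, rows from top to bottom.\<close>

definition ferrers :: "nat list \<Rightarrow> (nat \<times> nat) set" where
  "ferrers lam = {(i, j). i < length lam \<and> j < lam ! i}"

text \<open>
  A filling is a finite map whose domain is the diagram. A cell is sent to the pair of its
  integer value and a flag telling whether the entry is overlined.
\<close>

type_synonym filling = "nat \<times> nat \<Rightarrow> (nat \<times> bool) option"

definition entry :: "filling \<Rightarrow> nat \<times> nat \<Rightarrow> nat" where
  "entry P c = fst (the (P c))"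

definition overlined :: "filling \<Rightarrow> nat \<times> nat \<Rightarrow> bool" where
  "overlined P c \<longleftrightarrow> snd (the (P c))"

definition plane_overpartition :: "filling \<Rightarrow> bool" where
  "plane_overpartition P \<longleftrightarrow>
     (\<exists>lam. is_partition lam \<and> dom P = ferrers lam) \<and>
     (\<forall>c\<in>dom P. 0 < entry P c) \<and>
     (\<forall>i j j'. (i, j) \<in> dom P \<and> (i, j') \<in> dom P \<and> j < j' \<longrightarrow> entry P (i, j') \<le> entry P (i, j)) \<and>
     (\<forall>i i' j. (i, j) \<in> dom P \<and> (i', j) \<in> dom P \<and> i < i' \<longrightarrow> entry P (i', j) \<le> entry P (i, j)) \<and>
     (\<forall>i j j'. (i, j) \<in> dom P \<and> (i, j') \<in> dom P \<and> j < j' \<and> entry P (i, j) = entry P (i, j')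
        \<longrightarrow> \<not> overlined P (i, j)) \<and>
     (\<forall>i i' j. (i, j) \<in> dom P \<and> (i', j) \<in> dom P \<and> i < i' \<and> entry P (i, j) = entry P (i', j)
        \<longrightarrow> overlined P (i', j))"

definition weight :: "filling \<Rightarrow> nat" where
  "weight P = (\<Sum>c\<in>dom P. entry P c)"

definition num_overlined :: "filling \<Rightarrow> nat" where
  "num_overlined P = card {c \<in> dom P. overlined P c}"

definition plane_overpartitions_upto :: "nat \<Rightarrow> filling set" where
  "plane_overpartitions_upto n = {P. plane_overpartition P \<and> (\<forall>c\<in>dom P. entry P c \<le> n)}"

text \<open>
  Generating functions are formal power series in q (the series variable) over a field
  that contains a. As the field and a are arbitrary, a may be taken to be an indeterminate
  (e.g. the generator of a field of rational functions). Sums over infinite sets are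
  unordered sums in the standard metric on formal power series, i.e. they converge
  coefficientwise.
\<close>

end

theory Submission
  imports Defs
begin

text \<open>
  The entries of a plane overpartition, taken in the order of decreasing value with non-overlined
  copies before overlined ones, build up its diagram from the empty one by alternately adding a
  horizontal strip (the non-overlined copies of \<open>k\<close>, with variable \<open>q\<^sup>k\<close>) and a vertical strip
  (the overlined ones, with variable \<open>a q\<^sup>k\<close>). For a fixed shape this gives a super Schur
  function. To sum over all shapes, the outermost strip to be added is traded for a strip to be
  removed, which produces a factor \<open>1 / (1 - x)\<close>. Removing a strip is then commuted past all the
  other additions, with a factor \<open>1 / (1 - x y)\<close> for strips of the same type and \<open>1 + x y\<close> for
  strips of different types, until it hits the empty diagram and disappears.
\<close>

unbundle no vec_syntax and fps_syntax

subsection \<open>Locally finite sums of formal power series\<close>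

text \<open>Every letter has positive degree in \<open>q\<close>, so a shape with \<open>m\<close>
  cells contributes only from degree \<open>m\<close> on; this makes the sums over shapes converge.
  Iterated sums may exist merely through cancellation inside the inner ones, hence every interchange
  of two sums below starts from the summability of the double family. The outcome is the Littlewood
  identity for the sum of all Schur functions, in super variables: a factor
  \<open>1 / (1 - x)\<close> for each letter and one factor for each pair of letters. With the
  letters \<open>q^k\<close> and \<open>a q^k\<close> for \<open>k = 1..n\<close>, the mixed pairs
  give the numerator factors with \<open>i >= 1\<close>, and the pairs of equal type give the
  denominator factors except, for each \<open>j\<close>, \<open>1 - q^j\<close> and
  \<open>1 - a^2 q^(2j)\<close>. The former belongs to the letter \<open>q^j\<close>. The latter is
  \<open>(1 - a q^j) (1 + a q^j)\<close>, where \<open>1 + a q^j\<close> cancels the numerator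
  factor with \<open>i = 0\<close> and \<open>1 - a q^j\<close> belongs to the letter
  \<open>a q^j\<close>.\<close>

lemma fps_summable_onI:
  fixes f :: "'a \<Rightarrow> 'b::ab_group_add fps"
  assumes "\<And>m. finite {s\<in>A. f s $ m \<noteq> 0}"
  shows "f summable_on A"
proof -
  have "(f has_sum Abs_fps (\<lambda>m. \<Sum>s | s \<in> A \<and> f s $ m \<noteq> 0. f s $ m)) A"
    by (rule has_sum_fpsI) (use assms in auto)
  then show ?thesis
    by (auto simp: summable_on_def)
qed

text \<open>\<open>F\<close> may be any finite superset of the contributing indices, so that several
  coefficients can be summed over one common index set.\<close>

lemma has_sum_fps_nth:
  fixes f :: "'a \<Rightarrow> 'b::ab_group_add fps"
  assumes "(f has_sum S) A" "finite F" "{s\<in>A. f s $ m \<noteq> 0} \<subseteq> F" "F \<subseteq> A"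
  shows "S $ m = (\<Sum>s\<in>F. f s $ m)"
proof -
  have "S $ m = (\<Sum>s | s \<in> A \<and> f s $ m \<noteq> 0. f s $ m)"
    by (rule has_sum_fpsD(2)[OF assms(1)])
  also have "\<dots> = (\<Sum>s\<in>F. f s $ m)"
    by (rule sum.mono_neutral_left) (use assms in auto)
  finally show ?thesis .
qed

lemma has_sum_fps_unique:
  fixes f :: "'a \<Rightarrow> 'b::ab_group_add fps"
  assumes "(f has_sum S) A" "(f has_sum T) A"
  shows "S = T"
  using has_sum_fpsD(2)[OF assms(1)] has_sum_fpsD(2)[OF assms(2)] by (simp add: fps_eq_iff)

lemma has_sum_fps_cmult:
  fixes f :: "'a \<Rightarrow> 'b::ring fps"
  assumes "(f has_sum S) A"
  shows "((\<lambda>s. c * f s) has_sum c * S) A"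
proof -
  \<comment> \<open>Coefficient \<open>m\<close> of a product involves the coefficients of
    \<open>f s\<close> up to \<open>m\<close>; \<open>G m\<close> is a common finite index set for
    all of them.\<close>
  define G where "G = (\<lambda>m. \<Union>i\<in>{..m}. {s\<in>A. f s $ i \<noteq> 0})"
  have G: "finite (G m)" "G m \<subseteq> A" for m
    using has_sum_fpsD(1)[OF assms] by (auto simp: G_def)
  have sub: "{s\<in>A. (c * f s) $ m \<noteq> 0} \<subseteq> G m" for m
  proof
    fix s assume s: "s \<in> {s\<in>A. (c * f s) $ m \<noteq> 0}"
    then have "\<exists>i\<in>{0..m}. c $ i * f s $ (m - i) \<noteq> 0"
      by (auto simp: fps_mult_nth intro: sum.not_neutral_contains_not_neutral)
    then obtain i where "i \<le> m" "f s $ (m - i) \<noteq> 0" by (metis atLeastAtMost_iff mult_zero_right)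
    then show "s \<in> G m"
      unfolding G_def using s by (intro UN_I[of "m - i"]) auto
  qed
  show ?thesis
  proof (rule has_sum_fpsI)
    fix m
    show "finite {s\<in>A. (c * f s) $ m \<noteq> 0}"
      using sub G finite_subset by blast
    have "(c * S) $ m = (\<Sum>i=0..m. c $ i * (\<Sum>s\<in>G m. f s $ (m - i)))"
      unfolding fps_mult_nth
    proof (intro sum.cong refl arg_cong2[where f = "(*)"] has_sum_fps_nth[OF assms] G)
      fix i
      show "{s \<in> A. f s $ (m - i) \<noteq> 0} \<subseteq> G m"
        unfolding G_def by (rule UN_upper) simp
    qed
    also have "\<dots> = (\<Sum>s\<in>G m. (c * f s) $ m)"
      unfolding fps_mult_nth sum_distrib_left by (rule sum.swap)
    also have "\<dots> = (\<Sum>s | s \<in> A \<and> (c * f s) $ m \<noteq> 0. (c * f s) $ m)"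
      by (rule sum.mono_neutral_right) (use sub G(1) set_mp[OF G(2)] in auto)
    finally show "(c * S) $ m = (\<Sum>s | s \<in> A \<and> (c * f s) $ m \<noteq> 0. (c * f s) $ m)" .
  qed
qed

text \<open>Only the finite set \<open>T\<close> of pairs contributes to coefficient
  \<open>m\<close>, so the claim reduces to a finite double sum. The converse fails: nonzero terms
  may cancel within infinitely many inner sums.\<close>

lemma has_sum_fps_Sigma:
  fixes f :: "'a \<times> 'c \<Rightarrow> 'b::ab_group_add fps"
  assumes S: "(f has_sum S) (Sigma A B)"
    and b: "\<And>x. x \<in> A \<Longrightarrow> ((\<lambda>y. f (x, y)) has_sum b x) (B x)"
  shows "(b has_sum S) A"
proof (rule has_sum_fpsI)
  fix m
  define T where "T = {p \<in> Sigma A B. f p $ m \<noteq> 0}"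
  have T: "finite T" using has_sum_fpsD(1)[OF S] by (simp add: T_def)
  have bm: "b x $ m = (\<Sum>y | (x, y) \<in> T. f (x, y) $ m)" if "x \<in> A" for x
  proof (rule has_sum_fps_nth[OF b[OF that]])
    have "{y. (x, y) \<in> T} \<subseteq> snd ` T" by force
    then show "finite {y. (x, y) \<in> T}" using T finite_subset by blast
  qed (auto simp: T_def that)
  have sub: "{x\<in>A. b x $ m \<noteq> 0} \<subseteq> fst ` T"
  proof
    fix x assume x: "x \<in> {x\<in>A. b x $ m \<noteq> 0}"
    then have "{y. (x, y) \<in> T} \<noteq> {}" using bm[of x] by (metis (mono_tags) mem_Collect_eq sum.empty)
    then show "x \<in> fst ` T" by force
  qed
  then show "finite {x\<in>A. b x $ m \<noteq> 0}" using T finite_subset by blast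
  have "S $ m = (\<Sum>p\<in>T. f p $ m)"
    by (rule has_sum_fps_nth[OF S T]) (auto simp: T_def)
  also have "T = Sigma (fst ` T) (\<lambda>x. {y. (x, y) \<in> T})" by force
  also have "(\<Sum>p\<in>\<dots>. f p $ m) = (\<Sum>x\<in>fst ` T. \<Sum>y | (x, y) \<in> T. f (x, y) $ m)"
  proof (subst sum.Sigma)
    show "\<forall>x\<in>fst ` T. finite {y. (x, y) \<in> T}"
    proof
      fix x
      have "{y. (x, y) \<in> T} \<subseteq> snd ` T" by force
      then show "finite {y. (x, y) \<in> T}" using T finite_subset by blast
    qed
  qed (use T in auto)
  also have "\<dots> = (\<Sum>x\<in>fst ` T. b x $ m)"
    by (rule sum.cong) (auto simp: bm T_def)
  also have "\<dots> = (\<Sum>x | x \<in> A \<and> b x $ m \<noteq> 0. b x $ m)"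
    by (rule sum.mono_neutral_right) (use sub T in \<open>auto simp: T_def\<close>)
  finally show "S $ m = (\<Sum>x | x \<in> A \<and> b x $ m \<noteq> 0. b x $ m)" .
qed

lemma fps_X_power_dvd_nth:
  fixes f :: "'b::comm_ring_1 fps"
  assumes "fps_X ^ k dvd f" "m < k"
  shows "f $ m = 0"
  using assms by (auto simp: dvd_def fps_X_power_mult_nth)

lemma has_sum_fps_geometric:
  fixes z :: "'b::field fps"
  assumes "fps_X dvd z"
  shows "((\<lambda>k. z ^ k) has_sum inverse (1 - z)) UNIV"
proof -
  have z: "(z ^ k) $ m = 0" if "m < k" for k m
    by (rule fps_X_power_dvd_nth[OF _ that]) (use assms in \<open>auto intro: dvd_power_same\<close>)
  have "(\<lambda>k. z ^ k) summable_on UNIV"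
  proof (rule fps_summable_onI)
    show "finite {k \<in> UNIV. (z ^ k) $ m \<noteq> 0}" for m
      by (rule finite_subset[of _ "{..m}"]) (use z in \<open>auto simp: not_less[symmetric]\<close>)
  qed
  then obtain S where S: "((\<lambda>k. z ^ k) has_sum S) UNIV"
    by (auto simp: summable_on_def)
  \<comment> \<open>The sum over the positive exponents is computed twice, by shifting the exponent
    and by removing the term of exponent 0. Comparison gives \<open>(1 - z) * S = 1\<close>.\<close>
  have S1: "((\<lambda>k. z ^ k) has_sum z * S) (range Suc)"
    by (subst has_sum_reindex) (use has_sum_fps_cmult[OF S, of z] in \<open>auto simp: o_def\<close>)
  have S2: "((\<lambda>k. z ^ k) has_sum S - 1) (range Suc)"
  proof (rule has_sum_fpsI)
    fix m
    show "finite {k \<in> range Suc. (z ^ k) $ m \<noteq> 0}"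
      using has_sum_fpsD(1)[OF S, of m] by (rule finite_subset[rotated]) auto
    have "S $ m = (\<Sum>k\<in>insert 0 (Suc ` {..m}). (z ^ k) $ m)"
    proof (rule has_sum_fps_nth[OF S])
      show "{k \<in> UNIV. (z ^ k) $ m \<noteq> 0} \<subseteq> insert 0 (Suc ` {..m})"
      proof
        fix k assume "k \<in> {k \<in> UNIV. (z ^ k) $ m \<noteq> 0}"
        then have "k \<le> m" using z[of m k] by (auto simp: not_less[symmetric])
        then show "k \<in> insert 0 (Suc ` {..m})" by (cases k) auto
      qed
    qed auto
    also have "\<dots> = 1 $ m + (\<Sum>k\<in>Suc ` {..m}. (z ^ k) $ m)"
      by (subst sum.insert) auto
    also have "(\<Sum>k\<in>Suc ` {..m}. (z ^ k) $ m) = (\<Sum>k | k \<in> range Suc \<and> (z ^ k) $ m \<noteq> 0. (z ^ k) $ m)"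
    proof (rule sum.mono_neutral_right)
      show "{k \<in> range Suc. (z ^ k) $ m \<noteq> 0} \<subseteq> Suc ` {..m}"
      proof
        fix k assume k: "k \<in> {k \<in> range Suc. (z ^ k) $ m \<noteq> 0}"
        then have "k \<le> m" using z[of m k] by (auto simp: not_less[symmetric])
        then show "k \<in> Suc ` {..m}" using k by auto
      qed
    qed auto
    finally show "(S - 1) $ m = (\<Sum>k | k \<in> range Suc \<and> (z ^ k) $ m \<noteq> 0. (z ^ k) $ m)"
      by simp
  qed
  have eq: "(1 - z) * S = 1"
    using has_sum_fps_unique[OF S1 S2] by (simp add: algebra_simps)
  have "(1 - z) $ 0 \<noteq> 0"
    using z[of 0 1] by simp
  then have "inverse (1 - z) * ((1 - z) * S) = S"
    by (simp add: mult.assoc[symmetric] inverse_mult_eq_1)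
  then have "S = inverse (1 - z)"
    using eq by simp
  with S show ?thesis by simp
qed

subsection \<open>Young diagrams and strips\<close>

definition young :: "(nat \<times> nat) set \<Rightarrow> bool" where
  "young D \<longleftrightarrow> finite D \<and> (\<forall>i j i' j'. (i, j) \<in> D \<and> i' \<le> i \<and> j' \<le> j \<longrightarrow> (i', j') \<in> D)"

text \<open>The skew diagram \<open>mu - la\<close> is a vertical strip if \<open>v\<close> holds and a horizontal strip otherwise.\<close>

definition strip :: "bool \<Rightarrow> (nat \<times> nat) set \<Rightarrow> (nat \<times> nat) set \<Rightarrow> bool" where
  "strip v la mu \<longleftrightarrow> la \<subseteq> mu \<and>
     (\<forall>i j. (if v then (i, Suc j) else (Suc i, j)) \<in> mu \<longrightarrow> (i, j) \<in> la)"

lemma young_finite: "young D \<Longrightarrow> finite D"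
  by (simp add: young_def)

lemma young_down: "young D \<Longrightarrow> (i, j) \<in> D \<Longrightarrow> i' \<le> i \<Longrightarrow> j' \<le> j \<Longrightarrow> (i', j') \<in> D"
  unfolding young_def by blast

lemma strip_subset: "strip v la mu \<Longrightarrow> la \<subseteq> mu"
  by (simp add: strip_def)

text \<open>A cell \<open>(i, j)\<close> forces the whole rectangle
  \<open>{..i} \<times> {..j}\<close> into the diagram, so both coordinates are bounded by the
  number of cells.\<close>

lemma finite_young_card_le: "finite {D. young D \<and> card D \<le> m}"
proof (rule finite_subset)
  show "{D. young D \<and> card D \<le> m} \<subseteq> Pow ({..m} \<times> {..m})"
  proof (intro subsetI PowI, elim CollectE conjE)
    fix D c assume D: "young D" "card D \<le> m" and c: "c \<in> D"
    obtain i j where ij: "c = (i, j)" by force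
    have "{..i} \<times> {..j} \<subseteq> D"
      using young_down[OF D(1), of i j] c ij by auto
    then have "card ({..i} \<times> {..j}) \<le> m"
      using D card_mono young_finite le_trans by metis
    then have "Suc i * Suc j \<le> m" by (simp add: card_cartesian_product)
    moreover have "Suc i \<le> Suc i * Suc j" "Suc j \<le> Suc i * Suc j" by auto
    ultimately show "c \<in> {..m} \<times> {..m}" using ij by auto
  qed
qed simp

lemma finite_subdiagrams: "young mu \<Longrightarrow> finite {la. young la \<and> strip v la mu}"
  by (rule finite_subset[of _ "Pow mu"]) (auto simp: young_finite dest: strip_subset)

section \<open>Diagrams described by their row lengths\<close>

definition diag :: "(nat \<Rightarrow> nat) \<Rightarrow> (nat \<times> nat) set" where
  "diag r = {(i, j). j < r i}"

lemma diag_mem [simp]: "(i, j) \<in> diag r \<longleftrightarrow> j < r i"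
  by (simp add: diag_def)

lemma inj_diag: "inj diag"
proof (rule inj_on_inverseI[where g = "\<lambda>D i. card {j. (i, j) \<in> D}"])
  fix r :: "nat \<Rightarrow> nat"
  show "(\<lambda>i. card {j. (i, j) \<in> diag r}) = r"
    by (simp add: fun_eq_iff flip: lessThan_def)
qed

lemma diag_Sigma:
  assumes "\<And>i. i \<ge> N \<Longrightarrow> r i = 0"
  shows "diag r = Sigma {..<N} (\<lambda>i. {..<r i})"
  using assms by (auto simp: diag_def) (metis not_less less_zeroE)

lemma card_diag:
  assumes "\<And>i. i \<ge> N \<Longrightarrow> r i = 0"
  shows "card (diag r) = (\<Sum>i<N. r i)"
  using diag_Sigma[OF assms] by simp

lemma young_diag:
  assumes "antimono r" "\<And>i. i \<ge> N \<Longrightarrow> r i = 0"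
  shows "young (diag r)"
proof -
  have "finite (diag r)"
    using diag_Sigma[OF assms(2)] by simp
  then show ?thesis
    unfolding young_def using antimonoD[OF assms(1)]
    by (auto intro: le_less_trans less_le_trans)
qed

lemma youngE:
  assumes "young D"
  obtains r N where "D = diag r" "antimono r" "\<And>i. i \<ge> N \<Longrightarrow> r i = 0"
proof -
  define r where "r i = card {j. (i, j) \<in> D}" for i
  have fin: "finite {j. (i, j) \<in> D}" for i
    by (rule finite_subset[of _ "snd ` D"]) (use young_finite[OF assms] in force)+
  have mem: "(i, j) \<in> D \<longleftrightarrow> j < r i" for i j
  proof
    assume "(i, j) \<in> D"
    then have "{..j} \<subseteq> {j. (i, j) \<in> D}"
      using young_down[OF assms] by auto
    from card_mono[OF fin this] show "j < r i" by (simp add: r_def)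
  next
    assume j: "j < r i"
    show "(i, j) \<in> D"
    proof (rule ccontr)
      assume "(i, j) \<notin> D"
      then have "{j. (i, j) \<in> D} \<subseteq> {..<j}"
        using young_down[OF assms] by (auto simp: not_le[symmetric])
      from card_mono[OF _ this] j show False by (simp add: r_def)
    qed
  qed
  have "antimono r"
  proof (rule antimonoI, rule ccontr)
    fix i i' assume ii: "i \<le> i'" and "\<not> r i' \<le> r i"
    then have "(i', r i) \<in> D" using mem by auto
    then have "(i, r i) \<in> D" using young_down[OF assms] ii by blast
    then show False using mem by blast
  qed
  moreover obtain N where N: "\<forall>i\<in>fst ` D. i < N"
    using young_finite[OF assms] finite_nat_set_iff_bounded by blast
  have "r i = 0" if "i \<ge> N" for i
    using mem[of i 0] N that by force
  moreover have "D = diag r" using mem by auto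
  ultimately show ?thesis using that by blast
qed

lemma strip_diag_horizontal:
  "strip False (diag l) (diag m) \<longleftrightarrow> (\<forall>i. l i \<le> m i \<and> m (Suc i) \<le> l i)"
proof -
  have "a \<le> b \<longleftrightarrow> (\<forall>j. j < a \<longrightarrow> j < b)" for a b :: nat
    by (metis less_le_trans not_le order_refl)
  then show ?thesis
    unfolding strip_def subset_iff by auto
qed

lemma strip_diag_vertical:
  "strip True (diag l) (diag m) \<longleftrightarrow> (\<forall>i. l i \<le> m i \<and> m i \<le> Suc (l i))"
proof -
  have "l i \<le> m i \<longleftrightarrow> (\<forall>j. j < l i \<longrightarrow> j < m i)" for i
    by (metis less_le_trans not_le order_refl)
  moreover have "m i \<le> Suc (l i) \<longleftrightarrow> (\<forall>j. Suc j < m i \<longrightarrow> j < l i)" for i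
    by (metis Suc_lessI Suc_less_eq le_imp_less_Suc less_Suc_eq_le less_le_trans not_le order_refl)
  ultimately show ?thesis
    unfolding strip_def subset_iff by auto
qed

subsection \<open>Commutation of adding and removing strips\<close>

text \<open>
  A partition is encoded by its row lengths. For row lengths \<open>l\<close> and \<open>n\<close>, the row lengths
  of a diagram obtained from both by adding horizontal strips satisfy independent
  conditions in each row, as do those obtained by removing horizontal strips. Reflecting the
  interval for row \<open>i + 1\<close> of the larger diagram gives the interval for row \<open>i\<close> of
  the smaller one; only the first row of the larger diagram is unbounded.
\<close>

lemma sum_horizontal_horizontal_rows:
  fixes x y :: "'k::field fps"
  assumes N: "\<And>i. i \<ge> N \<Longrightarrow> l i = 0" "\<And>i. i \<ge> N \<Longrightarrow> n i = 0"
    and X: "fps_X dvd x * y"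
  defines "M \<equiv> {m. \<forall>i. n i \<le> m i \<and> m (Suc i) \<le> n i \<and> l i \<le> m i \<and> m (Suc i) \<le> l i}"
    and "K \<equiv> {k. \<forall>i. k i \<le> l i \<and> l (Suc i) \<le> k i \<and> k i \<le> n i \<and> n (Suc i) \<le> k i}"
  shows "((\<lambda>m. x ^ (card (diag m) - card (diag n)) * y ^ (card (diag m) - card (diag l))) has_sum
    inverse (1 - x * y) *
      (\<Sum>k\<in>K. x ^ (card (diag l) - card (diag k)) * y ^ (card (diag n) - card (diag k)))) M"
proof -
  \<comment> \<open>\<open>c\<close> is the excess of row 0 over its least possible length, and
    \<open>k i\<close> determines row \<open>Suc i\<close> by reflection. On \<open>K\<close> and
    \<open>M\<close> none of the subtractions truncates.\<close>
  define phi where "phi = (\<lambda>(k, c) i. case i of 0 \<Rightarrow> c + max (l 0) (n 0)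
    | Suc i \<Rightarrow> max (l (Suc i)) (n (Suc i)) + min (l i) (n i) - (k i :: nat))"
  define psi where "psi = (\<lambda>m. (\<lambda>i. max (l (Suc i)) (n (Suc i)) + min (l i) (n i) - m (Suc i),
      m 0 - max (l 0) (n 0) :: nat))"
  have bij: "bij_betw phi (K \<times> UNIV) M"
  proof (rule bij_betw_byWitness[where f' = psi])
    show "\<forall>p\<in>K \<times> UNIV. psi (phi p) = p"
    proof (clarify)
      fix k c assume "k \<in> K"
      then have k: "k i \<le> min (l i) (n i)" for i by (auto simp: K_def)
      show "psi (phi (k, c)) = (k, c)"
      proof -
        have "b + min (l i) (n i) - (b + min (l i) (n i) - k i) = k i" for b i
          using k[of i] by linarith
        then show ?thesis by (simp add: psi_def phi_def)
      qed
    qed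
    show "\<forall>m\<in>M. phi (psi m) = m"
    proof
      fix m assume "m \<in> M"
      then have m: "m (Suc i) \<le> min (l i) (n i)" "max (l i) (n i) \<le> m i" for i by (auto simp: M_def)
      show "phi (psi m) = m"
      proof
        fix i show "phi (psi m) i = m i"
          using m(1)[of "i - 1"] m(2)[of i] by (cases i) (auto simp: psi_def phi_def)
      qed
    qed
    show "phi ` (K \<times> UNIV) \<subseteq> M"
    proof (clarify)
      fix k c assume "k \<in> K"
      then have k: "k i \<le> min (l i) (n i)" "max (l (Suc i)) (n (Suc i)) \<le> k i" for i
        by (auto simp: K_def)
      have "n i \<le> phi (k, c) i \<and> l i \<le> phi (k, c) i" for i
        using k[of "i - 1"] by (cases i) (auto simp: phi_def)
      moreover have "phi (k, c) (Suc i) \<le> n i \<and> phi (k, c) (Suc i) \<le> l i" for i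
        using k[of i] by (auto simp: phi_def)
      ultimately show "phi (k, c) \<in> M" by (auto simp: M_def)
    qed
    show "psi ` M \<subseteq> K \<times> UNIV"
    proof
      fix p assume "p \<in> psi ` M"
      then obtain m where "m \<in> M" and p: "p = psi m" by auto
      then have m: "m (Suc i) \<le> min (l i) (n i)" "max (l i) (n i) \<le> m i" for i by (auto simp: M_def)
      have "fst (psi m) i \<le> min (l i) (n i) \<and> max (l (Suc i)) (n (Suc i)) \<le> fst (psi m) i" for i
        using m(1)[of i] m(2)[of "Suc i"] by (auto simp: psi_def)
      then have "fst (psi m) \<in> K" by (auto simp: K_def)
      then show "p \<in> K \<times> UNIV" using p by (simp add: mem_Times_iff)
    qed
  qed
  define s where "s r = (\<Sum>i<N. r i)" for r :: "nat \<Rightarrow> nat"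
  have Kz: "k i = 0" if "k \<in> K" "i \<ge> N" for k i
    using that N(1)[of i] by (auto simp: K_def) (metis le_zero_eq)
  have Kle: "s k \<le> s l" "s k \<le> s n" if "k \<in> K" for k
    using that by (auto simp: K_def s_def intro!: sum_mono)
  have cl: "card (diag l) = s l" "card (diag n) = s n"
    using N by (auto simp: s_def intro!: card_diag)
  have ck: "card (diag k) = s k" if "k \<in> K" for k
    using Kz[OF that] by (auto simp: s_def intro!: card_diag)
  \<comment> \<open>Reflection turns \<open>k i\<close> into a maximum plus a minimum minus
    \<open>k i\<close>, and all maxima and minima add up to \<open>s l + s n\<close>. So, compared
    with the exponents for \<open>k\<close>, both exponents grow by \<open>c\<close>. The additive
    form avoids truncated subtraction; \<open>Suc N\<close> rows are needed because
    \<open>phi\<close> shifts the rows down by one.\<close>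
  have cm: "card (diag (phi (k, c))) + s k = c + s l + s n" if k: "k \<in> K" for k c
  proof -
    have "card (diag (phi (k, c))) = (\<Sum>i<Suc N. phi (k, c) i)"
    proof (rule card_diag)
      fix i assume "Suc N \<le> i"
      then show "phi (k, c) i = 0"
        using N(1)[of i] N(1)[of "i - 1"] N(2)[of i]
        by (cases i) (auto simp: phi_def)
    qed
    also have "\<dots> = phi (k, c) 0 + (\<Sum>i<N. phi (k, c) (Suc i))"
      by (rule sum.lessThan_Suc_shift)
    also have "\<dots> + s k = phi (k, c) 0 + (\<Sum>i<N. phi (k, c) (Suc i) + k i)"
      by (simp add: s_def sum.distrib)
    also have "(\<Sum>i<N. phi (k, c) (Suc i) + k i) = (\<Sum>i<N. max (l (Suc i)) (n (Suc i)) + min (l i) (n i))"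
    proof (rule sum.cong)
      fix i
      have "k i \<le> min (l i) (n i)" using k by (auto simp: K_def)
      then show "phi (k, c) (Suc i) + k i = max (l (Suc i)) (n (Suc i)) + min (l i) (n i)"
        by (simp add: phi_def trans_le_add2 del: min.bounded_iff)
    qed simp
    also have "phi (k, c) 0 + \<dots> = c + (max (l 0) (n 0) + (\<Sum>i<N. max (l (Suc i)) (n (Suc i))))
        + (\<Sum>i<N. min (l i) (n i))"
      by (simp add: phi_def sum.distrib)
    also have "max (l 0) (n 0) + (\<Sum>i<N. max (l (Suc i)) (n (Suc i))) = (\<Sum>i<Suc N. max (l i) (n i))"
      by (rule sum.lessThan_Suc_shift[symmetric])
    also have "\<dots> = (\<Sum>i<N. max (l i) (n i))"
      using N by simp
    also have "c + \<dots> + (\<Sum>i<N. min (l i) (n i)) = c + (\<Sum>i<N. l i + n i)"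
      by (simp add: add.assoc sum.distrib[symmetric] max_def min_def) (rule sum.cong, auto)
    finally show ?thesis by (simp add: s_def sum.distrib)
  qed
  have finK: "finite K"
  proof (rule finite_subset)
    show "K \<subseteq> {k. \<forall>i. (i \<in> {..<N} \<longrightarrow> k i \<in> {..s l}) \<and> (i \<notin> {..<N} \<longrightarrow> k i = 0)}"
    proof
      fix k assume k: "k \<in> K"
      have "k i \<le> s l" if "i < N" for i
        using Kle(1)[OF k] member_le_sum[of i "{..<N}" k] that by (auto simp: s_def)
      then show "k \<in> {k. \<forall>i. (i \<in> {..<N} \<longrightarrow> k i \<in> {..s l}) \<and> (i \<notin> {..<N} \<longrightarrow> k i = 0)}"
        using Kz[OF k] by auto
    qed
  qed (rule finite_set_of_finite_funs; simp)
  define w where "w k = x ^ (s l - s k) * y ^ (s n - s k)" for k :: "nat \<Rightarrow> nat"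
  have term_eq: "x ^ (card (diag (phi (k, c))) - card (diag n)) * y ^ (card (diag (phi (k, c))) - card (diag l))
      = w k * (x * y) ^ c" if "k \<in> K" for k c
  proof -
    have "card (diag (phi (k, c))) - card (diag n) = (s l - s k) + c"
      "card (diag (phi (k, c))) - card (diag l) = (s n - s k) + c"
      using cm[OF that, of c] Kle[OF that] by (auto simp: cl)
    then show ?thesis
      by (simp add: w_def power_add power_mult_distrib mult_ac)
  qed
  have nz: "(w k * (x * y) ^ c) $ m = 0" if "m < c" for k c m
    by (rule fps_X_power_dvd_nth[OF _ that]) (use X in \<open>auto intro: dvd_power_same dvd_mult\<close>)
  have "(\<lambda>(k, c). w k * (x * y) ^ c) summable_on (K \<times> UNIV)"
  proof (rule fps_summable_onI)
    fix m
    show "finite {p \<in> K \<times> UNIV. (case p of (k, c) \<Rightarrow> w k * (x * y) ^ c) $ m \<noteq> 0}"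
      by (rule finite_subset[of _ "K \<times> {..m}"]) (use nz finK in \<open>auto simp: not_less[symmetric]\<close>)
  qed
  then obtain S where S: "((\<lambda>(k, c). w k * (x * y) ^ c) has_sum S) (K \<times> UNIV)"
    by (auto simp: summable_on_def)
  have "((\<lambda>k. w k * inverse (1 - x * y)) has_sum S) K"
    by (rule has_sum_fps_Sigma[OF S])
       (simp add: has_sum_fps_cmult has_sum_fps_geometric X)
  from has_sum_fps_unique[OF this has_sum_finite[OF finK]]
  have S_eq: "S = inverse (1 - x * y) * (\<Sum>k\<in>K. w k)"
    by (simp only: sum_distrib_right[symmetric] mult.commute)
  have "((\<lambda>m. x ^ (card (diag m) - card (diag n)) * y ^ (card (diag m) - card (diag l))) has_sum S) M"
    unfolding has_sum_reindex_bij_betw[OF bij, symmetric]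
    using S by (rule has_sum_cong[THEN iffD1, rotated]) (auto simp: term_eq)
  also have "S = inverse (1 - x * y) *
      (\<Sum>k\<in>K. x ^ (card (diag l) - card (diag k)) * y ^ (card (diag n) - card (diag k)))"
    unfolding S_eq by (intro arg_cong2[where f = "(*)"] refl sum.cong) (auto simp: w_def cl ck)
  finally show ?thesis .
qed

text \<open>The distributive law for independent conditions on the rows. Since row lengths are
  functions on all of \<open>nat\<close>, the singleton \<open>{0}\<close> from row \<open>N\<close>
  on identifies them with the finite product \<open>PiE {..<N} B\<close>.\<close>

lemma sum_prod_rows:
  fixes f :: "nat \<Rightarrow> nat \<Rightarrow> 'a::comm_semiring_1"
  assumes "\<And>i. finite (B i)" "\<And>i. i \<ge> N \<Longrightarrow> B i = {0}"
  shows "finite {m. \<forall>i. m i \<in> B i}"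
    and "(\<Sum>m | \<forall>i. m i \<in> B i. \<Prod>i<N. f i (m i)) = (\<Prod>i<N. \<Sum>a\<in>B i. f i a)"
proof -
  have bij: "bij_betw (\<lambda>m. restrict m {..<N}) {m. \<forall>i. m i \<in> B i} (PiE {..<N} B)"
  proof (rule bij_betw_byWitness[where f' = "\<lambda>m i. if i < N then m i else 0"])
    show "\<forall>m\<in>{m. \<forall>i. m i \<in> B i}. (\<lambda>i. if i < N then restrict m {..<N} i else 0) = m"
    proof clarify
      fix m assume m: "\<forall>i. m i \<in> B i"
      then have "m i = 0" if "i \<ge> N" for i using assms(2)[OF that] by auto
      then show "(\<lambda>i. if i < N then restrict m {..<N} i else 0) = m"
        by (auto simp: fun_eq_iff)
    qed
    show "\<forall>m\<in>PiE {..<N} B. restrict (\<lambda>i. if i < N then m i else 0) {..<N} = m"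
      by (auto simp: fun_eq_iff restrict_def PiE_def extensional_def)
    show "(\<lambda>m i. if i < N then m i else 0) ` PiE {..<N} B \<subseteq> {m. \<forall>i. m i \<in> B i}"
      using assms(2) by auto
    show "(\<lambda>m. restrict m {..<N}) ` {m. \<forall>i. m i \<in> B i} \<subseteq> PiE {..<N} B"
      by (intro image_subsetI restrict_PiE_iff[THEN iffD2]) auto
  qed
  have "finite (PiE {..<N} B)" using assms by (auto intro: finite_PiE)
  then show "finite {m. \<forall>i. m i \<in> B i}"
    using bij_betw_finite[OF bij] by blast
  have "(\<Prod>i<N. \<Sum>a\<in>B i. f i a) = (\<Sum>m\<in>PiE {..<N} B. \<Prod>i<N. f i (m i))"
    by (rule prod_sum_PiE) (use assms in auto)
  also have "\<dots> = (\<Sum>m | \<forall>i. m i \<in> B i. \<Prod>i<N. f i (restrict m {..<N} i))"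
    by (rule sum.reindex_bij_betw[OF bij, symmetric])
  also have "\<dots> = (\<Sum>m | \<forall>i. m i \<in> B i. \<Prod>i<N. f i (m i))"
    by (intro sum.cong prod.cong) auto
  finally show "(\<Sum>m | \<forall>i. m i \<in> B i. \<Prod>i<N. f i (m i)) = (\<Prod>i<N. \<Sum>a\<in>B i. f i a)" ..
qed

text \<open>The vertical strip bounds the first row too, so all sums are finite: row
  \<open>i\<close> of \<open>m\<close> is \<open>l i\<close> or \<open>Suc (l i)\<close>, and row
  \<open>i\<close> of \<open>k\<close> is \<open>n i - 1\<close> or \<open>n i\<close>. The sums
  factor over the rows, and the row sums are compared as polynomials instead of matching single row
  lengths.\<close>

lemma sum_horizontal_vertical_rows:
  fixes x y :: "'k::field fps"
  assumes N: "\<And>i. i \<ge> N \<Longrightarrow> l i = 0" "\<And>i. i \<ge> N \<Longrightarrow> n i = 0"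
    and anti: "antimono l" "antimono n"
  defines "M \<equiv> {m. \<forall>i. n i \<le> m i \<and> m (Suc i) \<le> n i \<and> l i \<le> m i \<and> m i \<le> Suc (l i)}"
    and "K \<equiv> {k. \<forall>i. k i \<le> l i \<and> l (Suc i) \<le> k i \<and> k i \<le> n i \<and> n i \<le> Suc (k i)}"
  shows "finite M"
    and "(\<Sum>m\<in>M. x ^ (card (diag m) - card (diag n)) * y ^ (card (diag m) - card (diag l))) =
      (1 + x * y) * (\<Sum>k\<in>K. x ^ (card (diag l) - card (diag k)) * y ^ (card (diag n) - card (diag k)))"
proof -
  define Mi where "Mi i = {a. n i \<le> a \<and> (i > 0 \<longrightarrow> a \<le> n (i - 1)) \<and> l i \<le> a \<and> a \<le> Suc (l i)}" for i
  define Ki where "Ki i = {a. a \<le> l i \<and> l (Suc i) \<le> a \<and> a \<le> n i \<and> n i \<le> Suc a}" for i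
  \<comment> \<open>Row \<open>N\<close> of \<open>m\<close> may still have length 1, just below the
    last row of \<open>n\<close>; only from row \<open>Suc N\<close> on does every row
    vanish.\<close>
  define N' where "N' = Suc N"
  have M_eq: "M = {m. \<forall>i. m i \<in> Mi i}"
  proof (intro set_eqI iffI)
    fix m assume "m \<in> M"
    then have m: "n i \<le> m i" "m (Suc i) \<le> n i" "l i \<le> m i" "m i \<le> Suc (l i)" for i
      by (auto simp: M_def)
    show "m \<in> {m. \<forall>i. m i \<in> Mi i}"
    proof clarify
      fix i show "m i \<in> Mi i" using m[of i] m(2)[of "i - 1"] by (auto simp: Mi_def)
    qed
  next
    fix m assume m: "m \<in> {m. \<forall>i. m i \<in> Mi i}"
    have "m (Suc i) \<le> n i" for i
    proof -
      have "m (Suc i) \<in> Mi (Suc i)" using m by blast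
      then show ?thesis by (simp add: Mi_def)
    qed
    then show "m \<in> M" using m by (auto simp: M_def Mi_def)
  qed
  have K_eq: "K = {k. \<forall>i. k i \<in> Ki i}" by (auto simp: K_def Ki_def)
  have fin: "finite (Mi i)" "finite (Ki i)" for i
    by (rule finite_subset[of _ "{..Suc (l i)}"]; auto simp: Mi_def Ki_def)+
  have Mz: "Mi i = {0}" if "i \<ge> N'" for i
    using that N(1)[of i] N(2)[of i] N(2)[of "i - 1"] by (auto simp: Mi_def N'_def)
  have Kz: "Ki i = {0}" if "i \<ge> N'" for i
    using that N(1)[of i] N(1)[of "Suc i"] N(2)[of i] by (auto simp: Ki_def N'_def)
  show "finite M" unfolding M_eq by (rule sum_prod_rows(1)[of Mi N']) (use fin Mz in auto)
  have cd: "card (diag r) = (\<Sum>i<N'. r i)" if "\<And>i. i \<ge> N' \<Longrightarrow> r i = 0" for r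
    by (rule card_diag) (use that in auto)
  have cl: "card (diag l) = (\<Sum>i<N'. l i)" "card (diag n) = (\<Sum>i<N'. n i)"
    by (rule cd, rule N, simp add: N'_def)+
  define P where "P i = (\<Sum>a\<in>Mi i. x ^ (a - n i) * y ^ (a - l i))" for i
  define Q where "Q i = (\<Sum>a\<in>Ki i. x ^ (l i - a) * y ^ (n i - a))" for i
  have "(\<Sum>m\<in>M. x ^ (card (diag m) - card (diag n)) * y ^ (card (diag m) - card (diag l)))
      = (\<Sum>m\<in>M. \<Prod>i<N'. x ^ (m i - n i) * y ^ (m i - l i))"
  proof (rule sum.cong)
    fix m assume m: "m \<in> M"
    have "m i = 0" if "i \<ge> N'" for i using m Mz[OF that] unfolding M_eq by auto
    then have "card (diag m) = (\<Sum>i<N'. m i)" by (rule cd)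
    moreover have "(\<Sum>i<N'. m i) - (\<Sum>i<N'. n i) = (\<Sum>i<N'. m i - n i)"
      "(\<Sum>i<N'. m i) - (\<Sum>i<N'. l i) = (\<Sum>i<N'. m i - l i)"
      using m by (auto simp: M_def intro!: sum_subtractf_nat[symmetric])
    ultimately show "x ^ (card (diag m) - card (diag n)) * y ^ (card (diag m) - card (diag l))
        = (\<Prod>i<N'. x ^ (m i - n i) * y ^ (m i - l i))"
      by (simp add: cl power_sum prod.distrib)
  qed simp
  also have "\<dots> = (\<Prod>i<N'. P i)"
    unfolding M_eq P_def by (rule sum_prod_rows(2)) (use fin Mz in auto)
  finally have sumM: "(\<Sum>m\<in>M. x ^ (card (diag m) - card (diag n)) * y ^ (card (diag m) - card (diag l)))
      = (\<Prod>i<N'. P i)" .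
  have "(\<Sum>k\<in>K. x ^ (card (diag l) - card (diag k)) * y ^ (card (diag n) - card (diag k)))
      = (\<Sum>k\<in>K. \<Prod>i<N'. x ^ (l i - k i) * y ^ (n i - k i))"
  proof (rule sum.cong)
    fix k assume k: "k \<in> K"
    have "k i = 0" if "i \<ge> N'" for i using k Kz[OF that] unfolding K_eq by auto
    then have "card (diag k) = (\<Sum>i<N'. k i)" by (rule cd)
    moreover have "(\<Sum>i<N'. l i) - (\<Sum>i<N'. k i) = (\<Sum>i<N'. l i - k i)"
      "(\<Sum>i<N'. n i) - (\<Sum>i<N'. k i) = (\<Sum>i<N'. n i - k i)"
      using k by (auto simp: K_def intro!: sum_subtractf_nat[symmetric])
    ultimately show "x ^ (card (diag l) - card (diag k)) * y ^ (card (diag n) - card (diag k))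
        = (\<Prod>i<N'. x ^ (l i - k i) * y ^ (n i - k i))"
      by (simp add: cl power_sum prod.distrib)
  qed simp
  also have "\<dots> = (\<Prod>i<N'. Q i)"
    unfolding K_eq Q_def by (rule sum_prod_rows(2)) (use fin Kz in auto)
  finally have sumK: "(\<Sum>k\<in>K. x ^ (card (diag l) - card (diag k)) * y ^ (card (diag n) - card (diag k)))
      = (\<Prod>i<N'. Q i)" .
  \<comment> \<open>\<open>P i\<close> and \<open>Q i\<close> differ by a factor that telescopes over the rows.\<close>
  define g where "g i = (if i = 0 \<or> l i < n (i - 1) then 1 + x * y else if l i = n (i - 1) then 1 else 0)" for i
  \<comment> \<open>In the generic case \<open>P i\<close> is a power of \<open>x\<close> times
    \<open>g i\<close>, and \<open>Q i\<close> is the same power of \<open>x\<close> times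
    \<open>g (Suc i)\<close>. If \<open>n i = Suc (l i)\<close>, then \<open>P i = Q i\<close> and
    both values of \<open>g\<close> are \<open>1 + x * y\<close>. In the infeasible cases both sides
    vanish, by an empty row set or by the value 0 of \<open>g\<close>.\<close>
  have step: "P i * g (Suc i) = Q i * g i" for i
  proof -
    have ai: "l (Suc i) \<le> l i" "i > 0 \<Longrightarrow> n i \<le> n (i - 1)"
      by (simp_all add: antimonoD[OF anti(1)] antimonoD[OF anti(2)])
    consider "n i > Suc (l i)" | "i > 0" "l i > n (i - 1)" | "l (Suc i) > n i"
      | "n i \<le> Suc (l i)" "i = 0 \<or> l i \<le> n (i - 1)" "l (Suc i) \<le> n i"
      by (meson not_le not_gr_zero)
    then show ?thesis
    proof cases
      case 1
      then have "Mi i = {}" "Ki i = {}" by (auto simp: Mi_def Ki_def)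
      then show ?thesis by (simp add: P_def Q_def)
    next
      case 2
      then have "Mi i = {}" by (auto simp: Mi_def)
      with 2 show ?thesis by (simp add: P_def g_def)
    next
      case 3
      then have "Ki i = {}" by (auto simp: Ki_def)
      with 3 show ?thesis by (simp add: Q_def g_def)
    next
      case 4
      show ?thesis
      proof (cases "n i = Suc (l i)")
        case True
        then have "Mi i = {Suc (l i)}" "Ki i = {l i}"
          using ai 4 by (auto simp: Mi_def Ki_def)
        moreover have "g i = 1 + x * y" "g (Suc i) = 1 + x * y"
          using True ai 4 by (auto simp: g_def)
        ultimately show ?thesis using True by (simp add: P_def Q_def)
      next
        case False
        then have nl: "n i \<le> l i" using 4 by simp
        have "P i = x ^ (l i - n i) * g i"
        proof (cases "i = 0 \<or> l i < n (i - 1)")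
          case True
          then have "Mi i = {l i, Suc (l i)}" using nl by (auto simp: Mi_def)
          moreover have "Suc (l i) - n i = Suc (l i - n i)" using nl by simp
          ultimately have "P i = x ^ (l i - n i) + x ^ Suc (l i - n i) * y"
            by (simp add: P_def)
          moreover have "g i = 1 + x * y" using True by (simp add: g_def)
          ultimately show ?thesis by (simp add: algebra_simps)
        next
          case False
          then have "Mi i = {l i}" using nl 4 by (auto simp: Mi_def)
          with False 4 show ?thesis by (simp add: P_def g_def)
        qed
        moreover have "Q i = x ^ (l i - n i) * g (Suc i)"
        proof (cases "l (Suc i) < n i")
          case True
          then have "Ki i = {n i - 1, n i}" using nl by (auto simp: Ki_def)
          moreover have "l i - (n i - 1) = Suc (l i - n i)" "n i - (n i - 1) = 1" "n i - 1 \<noteq> n i"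
            using True nl by auto
          ultimately have "Q i = x ^ Suc (l i - n i) * y + x ^ (l i - n i)"
            by (simp add: Q_def)
          moreover have "g (Suc i) = 1 + x * y" using True by (simp add: g_def)
          ultimately show ?thesis by (simp add: algebra_simps)
        next
          case False
          then have "Ki i = {n i}" using nl 4 by (auto simp: Ki_def)
          with False 4 show ?thesis by (simp add: Q_def g_def)
        qed
        ultimately show ?thesis by (simp add: mult_ac)
      qed
    qed
  qed
  have "(\<Prod>i<j. P i) * g j = (\<Prod>i<j. Q i) * g 0" for j
  proof (induction j)
    case (Suc j)
    have "(\<Prod>i<Suc j. P i) * g (Suc j) = (\<Prod>i<j. P i) * (P j * g (Suc j))"
      by (simp only: prod.lessThan_Suc mult_ac)
    also have "\<dots> = ((\<Prod>i<j. P i) * g j) * Q j"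
      unfolding step by (simp only: mult_ac)
    also have "\<dots> = (\<Prod>i<Suc j. Q i) * g 0"
      unfolding Suc.IH by (simp only: prod.lessThan_Suc mult_ac)
    finally show ?case .
  qed simp
  \<comment> \<open>No row above restricts row 0, so \<open>g 0 = 1 + x * y\<close>; and
    \<open>g N' = 1\<close> since \<open>l N'\<close> and \<open>n N\<close> are both 0.\<close>
  from this[of N'] have "(\<Prod>i<N'. P i) = (1 + x * y) * (\<Prod>i<N'. Q i)"
    using N by (simp add: g_def N'_def mult.commute)
  then show "(\<Sum>m\<in>M. x ^ (card (diag m) - card (diag n)) * y ^ (card (diag m) - card (diag l))) =
      (1 + x * y) * (\<Sum>k\<in>K. x ^ (card (diag l) - card (diag k)) * y ^ (card (diag n) - card (diag k)))"
    by (simp only: sumM sumK)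
qed

section \<open>Transposition, and the passage from row lengths back to diagrams\<close>

lemma young_swap [simp]: "young (prod.swap ` D) \<longleftrightarrow> young D"
proof -
  have "young (prod.swap ` D)" if "young D" for D
    unfolding young_def
  proof (intro conjI allI impI)
    show "finite (prod.swap ` D)" using young_finite[OF that] by simp
  next
    fix i j i' j' assume "(i, j) \<in> prod.swap ` D \<and> i' \<le> i \<and> j' \<le> j"
    then have "(j, i) \<in> D" "i' \<le> i" "j' \<le> j" by auto
    then have "(j', i') \<in> D" using young_down[OF that] by blast
    then show "(i', j') \<in> prod.swap ` D" by force
  qed
  from this[of D] this[of "prod.swap ` D"] show ?thesis by (auto simp: image_image)
qed

lemma card_swap_image [simp]: "card (prod.swap ` D) = card D"
  by (rule card_image) simp

lemma strip_swap [simp]: "strip v (prod.swap ` la) (prod.swap ` mu) \<longleftrightarrow> strip (\<not> v) la mu"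
proof -
  have "p \<in> prod.swap ` D \<longleftrightarrow> prod.swap p \<in> D" for p and D :: "(nat \<times> nat) set"
    by (cases p) force
  then show ?thesis
    unfolding strip_def subset_iff by (cases v) auto
qed

text \<open>Interlacing gives \<open>m (Suc i) <= l i <= m i\<close>, so every such \<open>m\<close>
  is antimono by itself. It can have one row more than \<open>l\<close>, whence the bound
  \<open>Suc N\<close> in the proof.\<close>

lemma horizontal_strips_above_diag:
  assumes N: "\<And>i. i \<ge> N \<Longrightarrow> l i = 0"
  shows "{D. young D \<and> strip False (diag l) D \<and> Q D} =
      diag ` {m. (\<forall>i. l i \<le> m i \<and> m (Suc i) \<le> l i) \<and> Q (diag m)}"
proof (intro set_eqI iffI)
  fix D assume "D \<in> {D. young D \<and> strip False (diag l) D \<and> Q D}"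
  then have D: "young D" "strip False (diag l) D" "Q D" by auto
  obtain m where "D = diag m" using youngE[OF D(1)] by blast
  with D show "D \<in> diag ` {m. (\<forall>i. l i \<le> m i \<and> m (Suc i) \<le> l i) \<and> Q (diag m)}"
    by (auto simp: strip_diag_horizontal)
next
  fix D assume "D \<in> diag ` {m. (\<forall>i. l i \<le> m i \<and> m (Suc i) \<le> l i) \<and> Q (diag m)}"
  then obtain m where D: "D = diag m" and m: "\<And>i. l i \<le> m i" "\<And>i. m (Suc i) \<le> l i" and Q: "Q (diag m)"
    by auto
  have "antimono m"
    by (rule decseq_SucI) (use m le_trans in blast)
  moreover have "m i = 0" if "i \<ge> Suc N" for i
    using m(2)[of "i - 1"] N[of "i - 1"] that by (cases i) auto
  ultimately have "young (diag m)" by (rule young_diag)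
  with D m Q show "D \<in> {D. young D \<and> strip False (diag l) D \<and> Q D}"
    by (simp add: strip_diag_horizontal)
qed

text \<open>For vertical strips the inequalities do not force \<open>k\<close> to be antimono, so
  this remains as a condition.\<close>

lemma strips_below_diag:
  assumes N: "\<And>i. i \<ge> N \<Longrightarrow> l i = 0"
  shows "{D. young D \<and> strip v D (diag l) \<and> Q D} =
      diag ` {k. antimono k \<and> strip v (diag k) (diag l) \<and> Q (diag k)}"
proof (intro set_eqI iffI)
  fix D assume "D \<in> {D. young D \<and> strip v D (diag l) \<and> Q D}"
  then have D: "young D" "strip v D (diag l)" "Q D" by auto
  obtain k where "D = diag k" "antimono k" using youngE[OF D(1)] by blast
  with D show "D \<in> diag ` {k. antimono k \<and> strip v (diag k) (diag l) \<and> Q (diag k)}"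
    by auto
next
  fix D assume "D \<in> diag ` {k. antimono k \<and> strip v (diag k) (diag l) \<and> Q (diag k)}"
  then obtain k where D: "D = diag k" and k: "antimono k" "strip v (diag k) (diag l)" "Q (diag k)"
    by auto
  have "k i = 0" if "i \<ge> N" for i
    using strip_subset[OF k(2)] N[OF that] by (metis diag_mem neq0_conv not_less0 subsetD)
  then have "young (diag k)" using k(1) by (intro young_diag)
  with D k show "D \<in> {D. young D \<and> strip v D (diag l) \<and> Q D}" by simp
qed

lemma commute_strips_horizontal_horizontal:
  fixes x y :: "'k::field fps"
  assumes la: "young la" and nu: "young nu" and X: "fps_X dvd x * y"
  shows "((\<lambda>mu. x ^ (card mu - card nu) * y ^ (card mu - card la)) has_sum
    inverse (1 - x * y) *
      (\<Sum>ka | young ka \<and> strip False ka la \<and> strip False ka nu.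
        x ^ (card la - card ka) * y ^ (card nu - card ka)))
    {mu. young mu \<and> strip False nu mu \<and> strip False la mu}"
proof -
  obtain l L where l: "la = diag l" "antimono l" "\<And>i. i \<ge> L \<Longrightarrow> l i = 0"
    using youngE[OF la] by blast
  obtain n N where n: "nu = diag n" "antimono n" "\<And>i. i \<ge> N \<Longrightarrow> n i = 0"
    using youngE[OF nu] by blast
  define M where "M = {m. \<forall>i. n i \<le> m i \<and> m (Suc i) \<le> n i \<and> l i \<le> m i \<and> m (Suc i) \<le> l i}"
  define K where "K = {k. \<forall>i. k i \<le> l i \<and> l (Suc i) \<le> k i \<and> k i \<le> n i \<and> n (Suc i) \<le> k i}"
  have M: "{mu. young mu \<and> strip False nu mu \<and> strip False la mu} = diag ` M"
    unfolding l(1) n(1)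
    by (subst horizontal_strips_above_diag[where N = N], rule n(3), assumption)
      (rule arg_cong[where f = "image diag"], auto simp: strip_diag_horizontal M_def)
  have anti: "antimono k" if "k \<in> K" for k
    by (rule decseq_SucI) (use that le_trans in \<open>unfold K_def, blast\<close>)
  have K: "{ka. young ka \<and> strip False ka la \<and> strip False ka nu} = diag ` K"
    unfolding l(1) n(1)
    by (subst strips_below_diag[where N = L], rule l(3), assumption)
      (rule arg_cong[where f = "image diag"], use anti in \<open>auto simp: strip_diag_horizontal K_def\<close>)
  have inj: "inj_on diag A" for A
    using inj_diag by (rule inj_on_subset) simp
  show ?thesis
    unfolding l(1) n(1) M[unfolded l(1) n(1)] K[unfolded l(1) n(1)] has_sum_reindex[OF inj] sum.reindex[OF inj] o_def M_def K_def
    by (rule sum_horizontal_horizontal_rows[of "max L N"]) (use l n X in auto)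
qed

lemma commute_strips_horizontal_vertical:
  fixes x y :: "'k::field fps"
  assumes la: "young la" and nu: "young nu"
  shows "((\<lambda>mu. x ^ (card mu - card nu) * y ^ (card mu - card la)) has_sum
    (1 + x * y) *
      (\<Sum>ka | young ka \<and> strip False ka la \<and> strip True ka nu.
        x ^ (card la - card ka) * y ^ (card nu - card ka)))
    {mu. young mu \<and> strip False nu mu \<and> strip True la mu}"
proof -
  obtain l L where l: "la = diag l" "antimono l" "\<And>i. i \<ge> L \<Longrightarrow> l i = 0"
    using youngE[OF la] by blast
  obtain n N where n: "nu = diag n" "antimono n" "\<And>i. i \<ge> N \<Longrightarrow> n i = 0"
    using youngE[OF nu] by blast
  define M where "M = {m. \<forall>i. n i \<le> m i \<and> m (Suc i) \<le> n i \<and> l i \<le> m i \<and> m i \<le> Suc (l i)}"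
  define K where "K = {k. \<forall>i. k i \<le> l i \<and> l (Suc i) \<le> k i \<and> k i \<le> n i \<and> n i \<le> Suc (k i)}"
  have M: "{mu. young mu \<and> strip False nu mu \<and> strip True la mu} = diag ` M"
    unfolding l(1) n(1)
    by (subst horizontal_strips_above_diag[where N = N], rule n(3), assumption)
      (rule arg_cong[where f = "image diag"], auto simp: strip_diag_vertical M_def)
  have anti: "antimono k" if "k \<in> K" for k
    by (rule decseq_SucI) (use that le_trans in \<open>unfold K_def, blast\<close>)
  have K: "{ka. young ka \<and> strip False ka la \<and> strip True ka nu} = diag ` K"
    unfolding l(1) n(1)
    by (subst strips_below_diag[where N = L], rule l(3), assumption)
      (rule arg_cong[where f = "image diag"], use anti in \<open>auto simp: strip_diag_horizontal strip_diag_vertical K_def\<close>)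
  have inj: "inj_on diag A" for A
    using inj_diag by (rule inj_on_subset) simp
  have *: "finite M"
    "(\<Sum>m\<in>M. x ^ (card (diag m) - card (diag n)) * y ^ (card (diag m) - card (diag l))) =
      (1 + x * y) * (\<Sum>k\<in>K. x ^ (card (diag l) - card (diag k)) * y ^ (card (diag n) - card (diag k)))"
    unfolding M_def K_def by (rule sum_horizontal_vertical_rows[of "max L N"]; use l n in simp)+
  show ?thesis
    unfolding l(1) n(1) M[unfolded l(1) n(1)] K[unfolded l(1) n(1)] has_sum_reindex[OF inj] sum.reindex[OF inj] o_def
    using has_sum_finite[OF *(1), of "\<lambda>m. x ^ (card (diag m) - card (diag n)) * y ^ (card (diag m) - card (diag l))"]
    unfolding *(2) .
qed

text \<open>The factor of a pair of letters in the Cauchy identity, or in the dual one if the types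
  differ.\<close>

definition strip_factor :: "bool \<Rightarrow> bool \<Rightarrow> 'k::field fps \<Rightarrow> 'k fps \<Rightarrow> 'k fps" where
  "strip_factor v w x y = (if v = w then inverse (1 - x * y) else 1 + x * y)"

text \<open>Transposition turns two vertical strips into two horizontal ones, and the case
  \<open>v\<close>, \<open>\<not> w\<close> is the mixed case with \<open>la\<close> and
  \<open>nu\<close>, and \<open>x\<close> and \<open>y\<close>, exchanged. Divisibility by
  \<open>fps_X\<close> concerns the product \<open>x * y\<close>, which leaves room for
  \<open>y = 1\<close>.\<close>

lemma commute_strips:
  fixes x y :: "'k::field fps"
  assumes la: "young la" and nu: "young nu" and X: "fps_X dvd x * y"
  shows "((\<lambda>mu. x ^ (card mu - card nu) * y ^ (card mu - card la)) has_sum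
    strip_factor v w x y *
      (\<Sum>ka | young ka \<and> strip v ka la \<and> strip w ka nu.
        x ^ (card la - card ka) * y ^ (card nu - card ka)))
    {mu. young mu \<and> strip v nu mu \<and> strip w la mu}"
proof -
  consider "\<not> v" "\<not> w" | "v" "w" | "\<not> v" "w" | "v" "\<not> w" by blast
  then show ?thesis
  proof cases
    case 1
    then show ?thesis
      using commute_strips_horizontal_horizontal[OF la nu X] by (simp add: strip_factor_def)
  next
    case 2
    let ?c = "image prod.swap :: (nat \<times> nat) set \<Rightarrow> (nat \<times> nat) set"
    have inv: "?c (?c D) = D" for D by (simp add: image_image)
    have st: "strip False D (?c E) \<longleftrightarrow> strip True (?c D) E" "strip False (?c D) E \<longleftrightarrow> strip True D (?c E)" for D E
      using strip_swap[of False "?c D" E] strip_swap[of False D "?c E"] by (simp_all add: inv)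
    have bij: "bij_betw ?c {D. young D \<and> strip True nu D \<and> strip True la D}
        {D. young D \<and> strip False (?c nu) D \<and> strip False (?c la) D}"
      by (rule bij_betw_byWitness[where f' = ?c]) (auto simp: inv st)
    have bij': "bij_betw ?c {D. young D \<and> strip True D la \<and> strip True D nu}
        {D. young D \<and> strip False D (?c la) \<and> strip False D (?c nu)}"
      by (rule bij_betw_byWitness[where f' = ?c]) (auto simp: inv st)
    have "young (?c la)" "young (?c nu)" using la nu by simp_all
    from commute_strips_horizontal_horizontal[OF this X] show ?thesis
      using 2 unfolding has_sum_reindex_bij_betw[OF bij, symmetric] sum.reindex_bij_betw[OF bij', symmetric]
      by (simp add: strip_factor_def)
  next
    case 3
    then show ?thesis
      using commute_strips_horizontal_vertical[OF la nu] by (simp add: strip_factor_def)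
  next
    case 4
    then show ?thesis
      using commute_strips_horizontal_vertical[OF nu la, of y x]
      by (simp add: strip_factor_def mult.commute conj_commute)
  qed
qed

subsection \<open>Generating functions of chains of strips\<close>

text \<open>
  The super Schur function of the shape: each letter \<open>(v, x)\<close> contributes a strip of type
  \<open>v\<close> with variable \<open>x\<close>; the head of the list is the outermost strip.
\<close>

fun super_schur :: "(bool \<times> 'k::field fps) list \<Rightarrow> (nat \<times> nat) set \<Rightarrow> 'k fps" where
  "super_schur [] mu = (if mu = {} then 1 else 0)"
| "super_schur ((v, x) # ts) mu =
    (\<Sum>la | young la \<and> strip v la mu. x ^ (card mu - card la) * super_schur ts la)"

lemma strip_card: "strip v la mu \<Longrightarrow> young mu \<Longrightarrow> card la \<le> card mu"
  by (simp add: card_mono strip_subset young_finite)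

text \<open>Each cell of \<open>mu\<close> carries one variable, and each variable is divisible by
  \<open>fps_X\<close>.\<close>

lemma fps_X_power_dvd_super_schur:
  assumes "young mu" "\<forall>t\<in>set ts. fps_X dvd snd t"
  shows "fps_X ^ card mu dvd super_schur ts mu"
  using assms
proof (induction ts arbitrary: mu)
  case (Cons t ts)
  obtain v x where t: "t = (v, x)" by force
  show ?case
    unfolding t super_schur.simps
  proof (rule dvd_sum)
    fix la assume la: "la \<in> {la. young la \<and> strip v la mu}"
    have "fps_X ^ (card mu - card la) * fps_X ^ card la dvd x ^ (card mu - card la) * super_schur ts la"
      using Cons la t by (intro mult_dvd_mono dvd_power_same) auto
    then show "fps_X ^ card mu dvd x ^ (card mu - card la) * super_schur ts la"
      using strip_card[of v la mu] la Cons.prems by (simp flip: power_add)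
  qed
qed auto

text \<open>The degree bounds the size of the first component, to which only finitely many second
  components belong. This supplies the joint summability that \<open>has_sum_fps_Sigma\<close>
  demands.\<close>

lemma summable_on_young_pairs:
  fixes f :: "(nat \<times> nat) set \<times> 'b \<Rightarrow> 'k::field fps"
  assumes "\<And>mu b. mu \<in> A \<Longrightarrow> b \<in> B mu \<Longrightarrow> fps_X ^ (card mu - c) dvd f (mu, b)"
    and "\<And>mu. mu \<in> A \<Longrightarrow> young mu \<and> finite (B mu)"
  shows "f summable_on Sigma A B"
proof (rule fps_summable_onI)
  fix m
  have "{p \<in> Sigma A B. f p $ m \<noteq> 0} \<subseteq> Sigma {mu\<in>A. card mu \<le> m + c} B"
  proof
    fix p assume "p \<in> {p \<in> Sigma A B. f p $ m \<noteq> 0}"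
    then obtain mu b where p: "p = (mu, b)" and mu: "mu \<in> A" "b \<in> B mu" "f (mu, b) $ m \<noteq> 0"
      by auto
    then have "\<not> m < card mu - c"
      using fps_X_power_dvd_nth[OF assms(1)[OF mu(1,2)]] by blast
    then show "p \<in> Sigma {mu\<in>A. card mu \<le> m + c} B" using mu p by auto
  qed
  moreover have "finite (Sigma {mu\<in>A. card mu \<le> m + c} B)"
    by (rule finite_SigmaI, rule finite_subset[OF _ finite_young_card_le[of "m + c"]]) (use assms(2) in auto)
  ultimately show "finite {p \<in> Sigma A B. f p $ m \<noteq> 0}" by (rule finite_subset)
qed

lemma has_sum_swap_Sigma:
  assumes "Sigma B D = (\<lambda>(a, b). (b, a)) ` Sigma A C"
  shows "((\<lambda>(a, b). f a b) has_sum S) (Sigma A C) \<longleftrightarrow> ((\<lambda>(b, a). f a b) has_sum S) (Sigma B D)"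
  unfolding assms by (subst has_sum_reindex) (auto simp: inj_on_def o_def case_prod_unfold)

text \<open>The outermost strip of the chain, from \<open>la\<close> to \<open>mu\<close>, and the
  added strip, from \<open>nu\<close> to \<open>mu\<close>, share the upper end \<open>mu\<close>.
  Commutation replaces it by a common lower end \<open>ka\<close>. Then \<open>la\<close> lies above
  \<open>ka\<close> by a strip of type \<open>v\<close>, summed by the induction hypothesis, and the
  strip from \<open>ka\<close> to \<open>nu\<close> is the outermost one of a chain for
  \<open>nu\<close>.\<close>

lemma has_sum_super_schur_strip:
  fixes x :: "'k::field fps"
  assumes x: "fps_X dvd x" and ts: "\<forall>t\<in>set ts. fps_X dvd snd t" and nu: "young nu"
  shows "((\<lambda>mu. x ^ (card mu - card nu) * super_schur ts mu) has_sum
    (\<Prod>(w, y)\<leftarrow>ts. strip_factor v w x y) * super_schur ts nu) {mu. young mu \<and> strip v nu mu}"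
  using ts nu
proof (induction ts arbitrary: nu)
  case Nil
  show ?case
  proof (rule has_sum_fpsI)
    fix m
    have sub: "{mu \<in> {mu. young mu \<and> strip v nu mu}. (x ^ (card mu - card nu) * super_schur [] mu) $ m \<noteq> 0} \<subseteq> {{}}"
      by auto
    then show "finite {mu \<in> {mu. young mu \<and> strip v nu mu}. (x ^ (card mu - card nu) * super_schur [] mu) $ m \<noteq> 0}"
      using finite_subset by blast
    \<comment> \<open>At the end of the chain only \<open>mu = {}\<close> is left, and the strip
      removed from it can only be empty.\<close>
    have e: "young {} " "strip v nu {} \<longleftrightarrow> nu = {}" by (auto simp: young_def strip_def)
    have "{mu \<in> {mu. young mu \<and> strip v nu mu}. (x ^ (card mu - card nu) * super_schur [] mu) $ m \<noteq> 0}
        = (if nu = {} \<and> m = 0 then {{}} else {})"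
      using e by (auto split: if_splits)
    then show "((\<Prod>(w, y)\<leftarrow>[]. strip_factor v w x y) * super_schur [] nu) $ m =
      (\<Sum>mu | mu \<in> {mu. young mu \<and> strip v nu mu} \<and> (x ^ (card mu - card nu) * super_schur [] mu) $ m \<noteq> 0.
        (x ^ (card mu - card nu) * super_schur [] mu) $ m)"
      by simp
  qed
next
  case (Cons t ts)
  obtain w y where t: "t = (w, y)" by force
  have y: "fps_X dvd y" and ts: "\<forall>t\<in>set ts. fps_X dvd snd t" using Cons.prems t by auto
  note nu = Cons.prems(2)
  define F where "F mu la = x ^ (card mu - card nu) * (y ^ (card mu - card la) * super_schur ts la)" for mu la :: "(nat \<times> nat) set"
  have "(\<lambda>(mu, la). F mu la) summable_on
      Sigma {mu. young mu \<and> strip v nu mu} (\<lambda>mu. {la. young la \<and> strip w la mu})"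
  proof (rule summable_on_young_pairs[where c = 0])
    fix mu la
    assume *: "mu \<in> {mu. young mu \<and> strip v nu mu}" "la \<in> {la. young la \<and> strip w la mu}"
    then have "fps_X ^ (card mu - card la) * fps_X ^ card la dvd y ^ (card mu - card la) * super_schur ts la"
      by (intro mult_dvd_mono dvd_power_same y fps_X_power_dvd_super_schur ts) auto
    then show "fps_X ^ (card mu - 0) dvd (case (mu, la) of (mu, la) \<Rightarrow> F mu la)"
      using strip_card[of w la mu] * by (simp add: F_def[abs_def] flip: power_add)
  qed (simp add: finite_subdiagrams)
  then obtain S where S: "((\<lambda>(mu, la). F mu la) has_sum S)
      (Sigma {mu. young mu \<and> strip v nu mu} (\<lambda>mu. {la. young la \<and> strip w la mu}))"
    by (auto simp: summable_on_def)
  have sumS: "((\<lambda>mu. x ^ (card mu - card nu) * super_schur (t # ts) mu) has_sum S) {mu. young mu \<and> strip v nu mu}"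
  proof (rule has_sum_fps_Sigma[OF S])
    fix mu assume "mu \<in> {mu. young mu \<and> strip v nu mu}"
    then show "((\<lambda>la. case (mu, la) of (mu, la) \<Rightarrow> F mu la) has_sum
        x ^ (card mu - card nu) * super_schur (t # ts) mu) {la. young la \<and> strip w la mu}"
      using has_sum_finite[OF finite_subdiagrams[of mu w], of "F mu"]
      by (simp add: F_def[abs_def] t sum_distrib_left)
  qed
  define K where "K la = {ka. young ka \<and> strip v ka la \<and> strip w ka nu}" for la :: "(nat \<times> nat) set"
  define E where "E la = (\<Sum>ka\<in>K la. x ^ (card la - card ka) * y ^ (card nu - card ka)) * super_schur ts la" for la
  have S': "((\<lambda>(la, mu). F mu la) has_sum S)
      (Sigma {la. young la} (\<lambda>la. {mu. young mu \<and> strip v nu mu \<and> strip w la mu}))"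
    by (rule has_sum_swap_Sigma[THEN iffD1, OF _ S]) (auto simp: image_def)
  have sumE: "((\<lambda>la. strip_factor v w x y * E la) has_sum S) {la. young la}"
  proof (rule has_sum_fps_Sigma[OF S'])
    fix la assume "la \<in> {la. young la}"
    then have "young la" by simp
    from has_sum_fps_cmult[OF commute_strips[OF this nu, of x y v w], of "super_schur ts la"] x
    show "((\<lambda>mu. case (la, mu) of (la, mu) \<Rightarrow> F mu la) has_sum strip_factor v w x y * E la)
        {mu. young mu \<and> strip v nu mu \<and> strip w la mu}"
      by (simp add: F_def[abs_def] E_def K_def mult_ac)
  qed
  define G where "G ka la = y ^ (card nu - card ka) * (x ^ (card la - card ka) * super_schur ts la)" for ka la :: "(nat \<times> nat) set"
  have finK: "finite (K la)" for la
    unfolding K_def by (rule finite_subset[OF _ finite_subdiagrams[OF nu, of w]]) auto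
  have "(\<lambda>(la, ka). G ka la) summable_on Sigma {la. young la} K"
  proof (rule summable_on_young_pairs[where c = 0])
    fix la ka
    assume *: "la \<in> {la. young la}" "ka \<in> K la"
    then have "fps_X ^ card la dvd super_schur ts la"
      by (intro fps_X_power_dvd_super_schur ts) auto
    then show "fps_X ^ (card la - 0) dvd (case (la, ka) of (la, ka) \<Rightarrow> G ka la)"
      by (simp add: G_def[abs_def])
  qed (simp add: finK)
  then obtain T where T: "((\<lambda>(la, ka). G ka la) has_sum T) (Sigma {la. young la} K)"
    by (auto simp: summable_on_def)
  have "(E has_sum T) {la. young la}"
  proof (rule has_sum_fps_Sigma[OF T])
    fix la
    show "((\<lambda>ka. case (la, ka) of (la, ka) \<Rightarrow> G ka la) has_sum E la) (K la)"
      using has_sum_finite[OF finK, of "\<lambda>ka. G ka la" la]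
      by (simp add: G_def[abs_def] E_def sum_distrib_left mult_ac)
  qed
  from has_sum_fps_cmult[OF this] have ST: "S = strip_factor v w x y * T"
    by (rule has_sum_fps_unique[OF sumE])
  have T': "((\<lambda>(ka, la). G ka la) has_sum T)
      (Sigma {ka. young ka \<and> strip w ka nu} (\<lambda>ka. {la. young la \<and> strip v ka la}))"
    by (rule has_sum_swap_Sigma[THEN iffD1, OF _ T]) (auto simp: image_def K_def)
  define C where "C = (\<Prod>(w, y)\<leftarrow>ts. strip_factor v w x y)"
  have "((\<lambda>ka. y ^ (card nu - card ka) * (C * super_schur ts ka)) has_sum T) {ka. young ka \<and> strip w ka nu}"
  proof (rule has_sum_fps_Sigma[OF T'])
    fix ka assume "ka \<in> {ka. young ka \<and> strip w ka nu}"
    then show "((\<lambda>la. case (ka, la) of (ka, la) \<Rightarrow> G ka la) has_sum y ^ (card nu - card ka) * (C * super_schur ts ka))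
        {la. young la \<and> strip v ka la}"
      using Cons.IH[OF ts, of ka] by (simp add: G_def[abs_def] C_def has_sum_fps_cmult)
  qed
  from has_sum_fps_unique[OF this has_sum_finite[OF finite_subdiagrams[OF nu]]]
  have "T = C * super_schur (t # ts) nu"
    by (simp add: t sum_distrib_left mult_ac)
  then show ?case
    using sumS ST by (simp add: C_def t mult.assoc del: super_schur.simps)
qed

text \<open>The product side of the Littlewood identity: one \<open>inverse (1 - x)\<close> per
  letter, and one \<open>strip_factor\<close> per pair of letters in list order.\<close>

fun super_schur_total :: "(bool \<times> 'k::field fps) list \<Rightarrow> 'k fps" where
  "super_schur_total [] = 1"
| "super_schur_total ((v, x) # ts) =
    inverse (1 - x) * (\<Prod>(w, y)\<leftarrow>ts. strip_factor v w x y) * super_schur_total ts"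

text \<open>
  The case \<open>la = nu\<close>, \<open>y = 1\<close> of the commutation rule turns adding the outermost strip
  into removing a strip of the same type, which is then moved past all other strips.
\<close>

lemma has_sum_super_schur:
  fixes ts :: "(bool \<times> 'k::field fps) list"
  assumes "\<forall>t\<in>set ts. fps_X dvd snd t"
  shows "(super_schur ts has_sum super_schur_total ts) {mu. young mu}"
  using assms
proof (induction ts)
  case Nil
  have "(super_schur [] has_sum (1 :: 'k fps)) {{}}"
    using has_sum_finite[of "{{}}" "super_schur []"] by simp
  moreover have "(super_schur [] has_sum (1 :: 'k fps)) {{}} \<longleftrightarrow> (super_schur [] has_sum (1 :: 'k fps)) {mu. young mu}"
    by (rule has_sum_cong_neutral) (auto simp: young_def)
  ultimately show ?case unfolding super_schur_total.simps by blast
next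
  case (Cons t ts)
  obtain v x where t: "t = (v, x)" by force
  have x: "fps_X dvd x" and ts: "\<forall>t\<in>set ts. fps_X dvd snd t" using Cons.prems t by auto
  define F where "F mu la = x ^ (card mu - card la) * super_schur ts la" for mu la :: "(nat \<times> nat) set"
  have Fdvd: "fps_X ^ card mu dvd F mu la" if "young mu" "young la" "strip v la mu" for mu la
  proof -
    have "fps_X ^ (card mu - card la) * fps_X ^ card la dvd x ^ (card mu - card la) * super_schur ts la"
      using that by (intro mult_dvd_mono dvd_power_same x fps_X_power_dvd_super_schur ts) auto
    then show ?thesis
      using strip_card[of v la mu] that by (simp add: F_def[abs_def] flip: power_add)
  qed
  have "(\<lambda>(mu, la). F mu la) summable_on Sigma {mu. young mu} (\<lambda>mu. {la. young la \<and> strip v la mu})"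
    by (rule summable_on_young_pairs[where c = 0]) (simp_all add: finite_subdiagrams Fdvd)
  then obtain S where S: "((\<lambda>(mu, la). F mu la) has_sum S)
      (Sigma {mu. young mu} (\<lambda>mu. {la. young la \<and> strip v la mu}))"
    by (auto simp: summable_on_def)
  have sumS: "(super_schur (t # ts) has_sum S) {mu. young mu}"
  proof (rule has_sum_fps_Sigma[OF S])
    fix mu assume "mu \<in> {mu. young mu}"
    then show "((\<lambda>la. case (mu, la) of (mu, la) \<Rightarrow> F mu la) has_sum super_schur (t # ts) mu)
        {la. young la \<and> strip v la mu}"
      using has_sum_finite[OF finite_subdiagrams[of mu v], of "F mu"] by (simp add: F_def[abs_def] t)
  qed
  have S': "((\<lambda>(la, mu). F mu la) has_sum S) (Sigma {la. young la} (\<lambda>la. {mu. young mu \<and> strip v la mu}))"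
    by (rule has_sum_swap_Sigma[THEN iffD1, OF _ S]) (auto simp: image_def)
  define E where "E la = (\<Sum>ka | young ka \<and> strip v ka la. x ^ (card la - card ka) * super_schur ts la)" for la
  have sumE: "((\<lambda>la. inverse (1 - x) * E la) has_sum S) {la. young la}"
  proof (rule has_sum_fps_Sigma[OF S'])
    fix la assume "la \<in> {la. young la}"
    then have "young la" by simp
    from has_sum_fps_cmult[OF commute_strips[OF this this, of x 1 v v], of "super_schur ts la"] x
    show "((\<lambda>mu. case (la, mu) of (la, mu) \<Rightarrow> F mu la) has_sum inverse (1 - x) * E la)
        {mu. young mu \<and> strip v la mu}"
      by (simp add: F_def[abs_def] E_def strip_factor_def sum_distrib_left mult_ac)
  qed
  define G where "G ka la = x ^ (card la - card ka) * super_schur ts la" for ka la :: "(nat \<times> nat) set"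
  have "(\<lambda>(la, ka). G ka la) summable_on Sigma {la. young la} (\<lambda>la. {ka. young ka \<and> strip v ka la})"
  proof (rule summable_on_young_pairs[where c = 0])
    fix la ka
    assume "la \<in> {la. young la}"
    then have "fps_X ^ card la dvd super_schur ts la"
      by (intro fps_X_power_dvd_super_schur ts) auto
    then show "fps_X ^ (card la - 0) dvd (case (la, ka) of (la, ka) \<Rightarrow> G ka la)"
      by (simp add: G_def[abs_def])
  qed (simp add: finite_subdiagrams)
  then obtain T where T: "((\<lambda>(la, ka). G ka la) has_sum T)
      (Sigma {la. young la} (\<lambda>la. {ka. young ka \<and> strip v ka la}))"
    by (auto simp: summable_on_def)
  have "(E has_sum T) {la. young la}"
  proof (rule has_sum_fps_Sigma[OF T])
    fix la assume "la \<in> {la. young la}"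
    then show "((\<lambda>ka. case (la, ka) of (la, ka) \<Rightarrow> G ka la) has_sum E la) {ka. young ka \<and> strip v ka la}"
      using has_sum_finite[OF finite_subdiagrams[of la v], of "\<lambda>ka. G ka la"]
      by (simp add: G_def[abs_def] E_def)
  qed
  from has_sum_fps_cmult[OF this] have ST: "S = inverse (1 - x) * T"
    by (rule has_sum_fps_unique[OF sumE])
  have T': "((\<lambda>(ka, la). G ka la) has_sum T) (Sigma {ka. young ka} (\<lambda>ka. {la. young la \<and> strip v ka la}))"
    by (rule has_sum_swap_Sigma[THEN iffD1, OF _ T]) (auto simp: image_def)
  define C where "C = (\<Prod>(w, y)\<leftarrow>ts. strip_factor v w x y)"
  \<comment> \<open>For fixed \<open>ka\<close>, the sum over the strips of type \<open>v\<close>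
    above it just produces the constant \<open>C\<close>; what remains is the sum over all shapes
    for the shorter list.\<close>
  have "((\<lambda>ka. C * super_schur ts ka) has_sum T) {ka. young ka}"
  proof (rule has_sum_fps_Sigma[OF T'])
    fix ka assume "ka \<in> {ka. young ka}"
    then show "((\<lambda>la. case (ka, la) of (ka, la) \<Rightarrow> G ka la) has_sum C * super_schur ts ka) {la. young la \<and> strip v ka la}"
      using has_sum_super_schur_strip[OF x ts, of ka v] by (simp add: G_def[abs_def] C_def)
  qed
  from has_sum_fps_unique[OF this has_sum_fps_cmult[OF Cons.IH[OF ts]]]
  have "T = C * super_schur_total ts" .
  then show ?case
    using sumS ST by (simp add: C_def t mult.assoc del: super_schur.simps)
qed

subsection \<open>Plane overpartitions as super tableaux\<close>

text \<open>
  An entry of value \<open>v\<close> is encoded by \<open>2 v\<close> if overlined and by \<open>2 v + 1\<close> otherwise. Then a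
  plane overpartition is a weakly decreasing filling in which equal even codes form vertical
  strips and equal odd codes form horizontal strips.
\<close>

definition code :: "filling \<Rightarrow> nat \<times> nat \<Rightarrow> nat" where
  "code P c = 2 * entry P c + (if overlined P c then 0 else 1)"

definition tableau :: "filling \<Rightarrow> bool" where
  "tableau P \<longleftrightarrow> young (dom P) \<and>
     (\<forall>i j. (i, Suc j) \<in> dom P \<longrightarrow> code P (i, Suc j) < code P (i, j) \<or>
        code P (i, Suc j) = code P (i, j) \<and> odd (code P (i, j))) \<and>
     (\<forall>i j. (Suc i, j) \<in> dom P \<longrightarrow> code P (Suc i, j) < code P (i, j) \<or>
        code P (Suc i, j) = code P (i, j) \<and> even (code P (i, j)))"

lemma code_div_2: "code P c div 2 = entry P c"
  by (simp add: code_def)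

lemma even_code: "even (code P c) \<longleftrightarrow> overlined P c"
  by (simp add: code_def)

lemma map_eq_code:
  assumes "c \<in> dom P"
  shows "P c = Some (code P c div 2, even (code P c))"
  using assms by (auto simp: code_div_2 even_code entry_def overlined_def)

lemma tableau_young: "tableau P \<Longrightarrow> young (dom P)"
  by (simp add: tableau_def)

lemma tableau_right:
  "tableau P \<Longrightarrow> (i, Suc j) \<in> dom P \<Longrightarrow>
    code P (i, Suc j) < code P (i, j) \<or> code P (i, Suc j) = code P (i, j) \<and> odd (code P (i, j))"
  unfolding tableau_def by blast

lemma tableau_below:
  "tableau P \<Longrightarrow> (Suc i, j) \<in> dom P \<Longrightarrow>
    code P (Suc i, j) < code P (i, j) \<or> code P (Suc i, j) = code P (i, j) \<and> even (code P (i, j))"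
  unfolding tableau_def by blast

lemma tableau_row:
  assumes "tableau P" "(i, j + Suc d) \<in> dom P"
  shows "code P (i, j + Suc d) < code P (i, j) \<or>
    code P (i, j + Suc d) = code P (i, j) \<and> odd (code P (i, j))"
  using assms(2)
proof (induction d)
  case 0
  then show ?case using tableau_right[OF assms(1), of i j] by simp
next
  case (Suc d)
  have "(i, j + Suc d) \<in> dom P"
    by (rule young_down[OF tableau_young[OF assms(1)] Suc.prems]) simp_all
  from Suc.IH[OF this] tableau_right[OF assms(1), of i "j + Suc d"] Suc.prems show ?case
    by (simp only: add_Suc_right) auto
qed

lemma tableau_column:
  assumes "tableau P" "(i + Suc d, j) \<in> dom P"
  shows "code P (i + Suc d, j) < code P (i, j) \<or>
    code P (i + Suc d, j) = code P (i, j) \<and> even (code P (i, j))"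
  using assms(2)
proof (induction d)
  case 0
  then show ?case using tableau_below[OF assms(1), of i j] by simp
next
  case (Suc d)
  have "(i + Suc d, j) \<in> dom P"
    by (rule young_down[OF tableau_young[OF assms(1)] Suc.prems]) simp_all
  from Suc.IH[OF this] tableau_below[OF assms(1), of "i + Suc d" j] Suc.prems show ?case
    by (simp only: add_Suc_right) auto
qed

lemma tableau_antimono:
  assumes P: "tableau P" and ij: "(i, j) \<in> dom P" "i' \<le> i" "j' \<le> j"
  shows "code P (i, j) \<le> code P (i', j')"
proof -
  have "code P (i, j) \<le> code P (i, j')"
    using tableau_row[OF P, of i j' "j - Suc j'"] ij by (cases "j = j'") auto
  moreover have "(i, j') \<in> dom P"
    using young_down[OF tableau_young[OF P]] ij by blast
  then have "code P (i, j') \<le> code P (i', j')"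
    using tableau_column[OF P, of i' "i - Suc i'" j'] ij by (cases "i = i'") auto
  ultimately show ?thesis by simp
qed

lemma young_ferrers:
  assumes "is_partition lam"
  shows "young (ferrers lam)"
  unfolding young_def
proof (intro conjI allI impI)
  have "ferrers lam = Sigma {..<length lam} (\<lambda>i. {..<lam ! i})" by (auto simp: ferrers_def)
  then show "finite (ferrers lam)" by simp
next
  fix i j i' j' assume ij: "(i, j) \<in> ferrers lam \<and> i' \<le> i \<and> j' \<le> j"
  then have "i < length lam" "i' \<le> i" by (auto simp: ferrers_def)
  then have "lam ! i \<le> lam ! i'"
    using assms sorted_wrt_nth_less[of "(\<ge>)" lam i' i] by (cases "i = i'") (simp_all add: is_partition_def)
  then show "(i', j') \<in> ferrers lam" using ij by (auto simp: ferrers_def)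
qed

lemma young_imp_ferrers:
  assumes "young D"
  shows "\<exists>lam. is_partition lam \<and> D = ferrers lam"
proof -
  obtain r N where r: "D = diag r" "antimono r" "\<And>i. i \<ge> N \<Longrightarrow> r i = 0"
    using youngE[OF assms] by blast
  \<comment> \<open>Cutting at the first empty row makes all parts of the list positive.\<close>
  define L where "L = (LEAST i. r i = 0)"
  have L0: "r L = 0" unfolding L_def using LeastI[of "\<lambda>i. r i = 0" N] r(3)[of N] by simp
  have Lpos: "r i > 0" if "i < L" for i using not_less_Least[of i "\<lambda>i. r i = 0"] that by (simp add: L_def)
  have Lz: "r i = 0" if "i \<ge> L" for i using antimonoD[OF r(2) that] L0 by simp
  have "is_partition (map r [0..<L])"
    unfolding is_partition_def sorted_wrt_iff_nth_less
    using Lpos by (auto intro!: antimonoD[OF r(2)])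
  moreover have "(i, j) \<in> D \<longleftrightarrow> (i, j) \<in> ferrers (map r [0..<L])" for i j
    using Lz[of i] by (cases "i < L") (simp_all add: r(1) ferrers_def)
  then have "D = ferrers (map r [0..<L])"
    by (intro set_eqI) (simp add: split_paired_all)
  ultimately show ?thesis by blast
qed

text \<open>For equal values, the row condition says that the left cell has the odd code, and the
  column condition that the lower cell has the even code. Comparing neighbours is enough, since
  \<open>tableau_row\<close> and \<open>tableau_column\<close> propagate the comparison to all pairs
  of cells.\<close>

lemma plane_overpartition_iff_tableau:
  "plane_overpartition P \<longleftrightarrow> tableau P \<and> (\<forall>c\<in>dom P. 0 < entry P c)"
proof
  assume P: "plane_overpartition P"
  then have y: "young (dom P)" by (auto simp: plane_overpartition_def young_ferrers)
  have row: "entry P (i, j') \<le> entry P (i, j)" "entry P (i, j) = entry P (i, j') \<Longrightarrow> \<not> overlined P (i, j)"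
    if "(i, j') \<in> dom P" "j < j'" for i j j'
    using P young_down[OF y that(1), of i j] that unfolding plane_overpartition_def
    by (metis less_imp_le order_refl)+
  have col: "entry P (i', j) \<le> entry P (i, j)" "entry P (i, j) = entry P (i', j) \<Longrightarrow> overlined P (i', j)"
    if "(i', j) \<in> dom P" "i < i'" for i i' j
    using P young_down[OF y that(1), of i j] that unfolding plane_overpartition_def
    by (metis less_imp_le order_refl)+
  have "tableau P"
    unfolding tableau_def
  proof (intro conjI allI impI y)
    fix i j assume "(i, Suc j) \<in> dom P"
    with row[of i "Suc j" j]
    show "code P (i, Suc j) < code P (i, j) \<or> code P (i, Suc j) = code P (i, j) \<and> odd (code P (i, j))"
      by (cases "entry P (i, j) = entry P (i, Suc j)") (auto simp: code_def)
  next
    fix i j assume "(Suc i, j) \<in> dom P"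
    with col[of "Suc i" j i]
    show "code P (Suc i, j) < code P (i, j) \<or> code P (Suc i, j) = code P (i, j) \<and> even (code P (i, j))"
      by (cases "entry P (i, j) = entry P (Suc i, j)") (auto simp: code_def)
  qed
  then show "tableau P \<and> (\<forall>c\<in>dom P. 0 < entry P c)"
    using P by (simp add: plane_overpartition_def)
next
  assume P: "tableau P \<and> (\<forall>c\<in>dom P. 0 < entry P c)"
  have row: "entry P (i, j') \<le> entry P (i, j) \<and> (entry P (i, j) = entry P (i, j') \<longrightarrow> \<not> overlined P (i, j))"
    if "(i, j') \<in> dom P" "j < j'" for i j j'
    using tableau_row[of P i j "j' - Suc j"] P that by (auto simp: code_def split: if_splits)
  have col: "entry P (i', j) \<le> entry P (i, j) \<and> (entry P (i, j) = entry P (i', j) \<longrightarrow> overlined P (i', j))"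
    if "(i', j) \<in> dom P" "i < i'" for i i' j
    using tableau_column[of P i "i' - Suc i" j] P that by (auto simp: code_def split: if_splits)
  show "plane_overpartition P"
    unfolding plane_overpartition_def
    using young_imp_ferrers[OF tableau_young] P row col by blast
qed

section \<open>Peeling off the cells with the smallest code\<close>

definition tableaux :: "nat \<Rightarrow> nat \<Rightarrow> (nat \<times> nat) set \<Rightarrow> filling set" where
  "tableaux m L mu = {P. tableau P \<and> dom P = mu \<and> (\<forall>c\<in>mu. m \<le> code P c \<and> code P c < L)}"

text \<open>\<open>(m div 2, even m)\<close> is the entry whose code is \<open>m\<close>.\<close>

definition fill_rest :: "nat \<Rightarrow> (nat \<times> nat) set \<Rightarrow> filling \<Rightarrow> filling" where
  "fill_rest m mu P = (\<lambda>c. if c \<in> dom P then P c else if c \<in> mu then Some (m div 2, even m) else None)"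

lemma code_cong: "P c = Q c \<Longrightarrow> code P c = code Q c"
  by (simp add: code_def entry_def overlined_def)

lemma code_fill_rest:
  "c \<in> dom P \<Longrightarrow> code (fill_rest m mu P) c = code P c"
  "c \<in> mu \<Longrightarrow> c \<notin> dom P \<Longrightarrow> code (fill_rest m mu P) c = m"
  by (rule code_cong, simp add: fill_rest_def)
    (auto simp: code_def entry_def overlined_def fill_rest_def)

lemma dom_fill_rest: "dom P \<subseteq> mu \<Longrightarrow> dom (fill_rest m mu P) = mu"
  unfolding fill_rest_def dom_def by (force split: if_splits)

text \<open>As \<open>m\<close> is the least code, a cell of code \<open>m\<close> can be followed
  in its row, or column, only by another cell of code \<open>m\<close>. Evenness of \<open>m\<close>
  rules this out in rows and oddness in columns, so the cells of code \<open>m\<close> form a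
  strip.\<close>

lemma restrict_tableaux:
  assumes P: "P \<in> tableaux m L mu"
  defines "la \<equiv> {c\<in>mu. m < code P c}"
  shows "young la" "strip (even m) la mu" "P |` la \<in> tableaux (Suc m) L la" "fill_rest m mu (P |` la) = P"
proof -
  have t: "tableau P" and d: "dom P = mu" and c: "\<And>c. c \<in> mu \<Longrightarrow> m \<le> code P c \<and> code P c < L"
    using P by (auto simp: tableaux_def)
  have mu: "young mu" using tableau_young[OF t] d by simp
  have sub: "la \<subseteq> mu" by (auto simp: la_def)
  show young: "young la"
    unfolding young_def
  proof (intro conjI allI impI)
    show "finite la" using sub young_finite[OF mu] finite_subset by blast
  next
    fix i j i' j' assume ij: "(i, j) \<in> la \<and> i' \<le> i \<and> j' \<le> j"
    then have "(i', j') \<in> mu" using young_down[OF mu] sub by blast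
    moreover have "code P (i, j) \<le> code P (i', j')"
      using tableau_antimono[OF t] ij sub d by blast
    ultimately show "(i', j') \<in> la" using ij by (auto simp: la_def)
  qed
  show "strip (even m) la mu"
    unfolding strip_def
  proof (intro conjI allI impI sub)
    fix i j assume ij: "(if even m then (i, Suc j) else (Suc i, j)) \<in> mu"
    then have "(i, j) \<in> mu"
      using young_down[OF mu, of i "Suc j" i j] young_down[OF mu, of "Suc i" j i j] by (auto split: if_splits)
    moreover have "m < code P (i, j)"
    proof (cases "even m")
      case True
      then have "(i, Suc j) \<in> mu" using ij by simp
      with tableau_right[OF t, of i j] d c[of "(i, Suc j)"] True show ?thesis
        by (cases "code P (i, j) = m") auto
    next
      case False
      then have "(Suc i, j) \<in> mu" using ij by simp
      with tableau_below[OF t, of i j] d c[of "(Suc i, j)"] False show ?thesis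
        by (cases "code P (i, j) = m") auto
    qed
    ultimately show "(i, j) \<in> la" by (simp add: la_def)
  qed
  have dom: "dom (P |` la) = la" using sub d by auto
  have code: "code (P |` la) x = code P x" if "x \<in> la" for x
    using that by (intro code_cong) simp
  have "tableau (P |` la)"
    unfolding tableau_def dom
  proof (intro conjI allI impI young)
    fix i j assume ij: "(i, Suc j) \<in> la"
    then have "(i, j) \<in> la" using young_down[OF young, of i "Suc j" i j] by simp
    then show "code (P |` la) (i, Suc j) < code (P |` la) (i, j) \<or>
        code (P |` la) (i, Suc j) = code (P |` la) (i, j) \<and> odd (code (P |` la) (i, j))"
      using tableau_right[OF t, of i j] d sub ij by (auto simp: code)
  next
    fix i j assume ij: "(Suc i, j) \<in> la"
    then have "(i, j) \<in> la" using young_down[OF young, of "Suc i" j i j] by simp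
    then show "code (P |` la) (Suc i, j) < code (P |` la) (i, j) \<or>
        code (P |` la) (Suc i, j) = code (P |` la) (i, j) \<and> even (code (P |` la) (i, j))"
      using tableau_below[OF t, of i j] d sub ij by (auto simp: code)
  qed
  moreover have "Suc m \<le> code (P |` la) x \<and> code (P |` la) x < L" if "x \<in> la" for x
    using c[of x] that sub by (simp only: code) (auto simp: la_def)
  ultimately show "P |` la \<in> tableaux (Suc m) L la"
    unfolding tableaux_def using dom by blast
  show "fill_rest m mu (P |` la) = P"
  proof
    fix x
    show "fill_rest m mu (P |` la) x = P x"
    proof (cases "x \<in> mu - la")
      case True
      then have "code P x = m" using c[of x] by (auto simp: la_def)
      then show ?thesis using True map_eq_code[of x P] d dom by (simp add: fill_rest_def)
    next
      case False
      then show ?thesis using d sub unfolding fill_rest_def dom by (cases "P x") auto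
    qed
  qed
qed

lemma fill_rest_tableaux:
  assumes mu: "young mu" and "m < L" and st: "strip (even m) la mu"
    and P: "P \<in> tableaux (Suc m) L la"
  shows "fill_rest m mu P \<in> tableaux m L mu"
    and "{c\<in>mu. m < code (fill_rest m mu P) c} = la"
    and "fill_rest m mu P |` la = P"
proof -
  let ?F = "fill_rest m mu P"
  have t: "tableau P" and d: "dom P = la" and c: "\<And>c. c \<in> la \<Longrightarrow> m < code P c \<and> code P c < L"
    using P by (auto simp: tableaux_def Suc_le_eq)
  have la: "young la" using tableau_young[OF t] d by simp
  have sub: "la \<subseteq> mu" using st by (rule strip_subset)
  have dom: "dom ?F = mu" using dom_fill_rest d sub by blast
  have code: "code ?F x = (if x \<in> la then code P x else m)" if "x \<in> mu" for x
    using that code_fill_rest[where P = P and m = m and mu = mu and c = x] d by auto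
  have "tableau ?F"
    unfolding tableau_def dom
  proof (intro conjI allI impI mu)
    fix i j assume ij: "(i, Suc j) \<in> mu"
    have mem: "(i, j) \<in> mu" "(i, Suc j) \<in> la \<longrightarrow> (i, j) \<in> la"
      using young_down[OF mu, of i "Suc j" i j] young_down[OF la, of i "Suc j" i j] ij by auto
    \<comment> \<open>Two neighbours of code \<open>m\<close> in a row are allowed only for odd
      \<open>m\<close>; for even \<open>m\<close> the strip condition puts the left cell into
      \<open>la\<close>, where all codes exceed \<open>m\<close>.\<close>
    have "even m \<longrightarrow> (i, j) \<in> la" using st ij unfolding strip_def by metis
    then show "code ?F (i, Suc j) < code ?F (i, j) \<or> code ?F (i, Suc j) = code ?F (i, j) \<and> odd (code ?F (i, j))"
      using mem code[OF ij] code[OF mem(1)] tableau_right[OF t, of i j] d c[of "(i, j)"] by auto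
  next
    fix i j assume ij: "(Suc i, j) \<in> mu"
    have mem: "(i, j) \<in> mu" "(Suc i, j) \<in> la \<longrightarrow> (i, j) \<in> la"
      using young_down[OF mu, of "Suc i" j i j] young_down[OF la, of "Suc i" j i j] ij by auto
    have "odd m \<longrightarrow> (i, j) \<in> la" using st ij unfolding strip_def by metis
    then show "code ?F (Suc i, j) < code ?F (i, j) \<or> code ?F (Suc i, j) = code ?F (i, j) \<and> even (code ?F (i, j))"
      using mem code[OF ij] code[OF mem(1)] tableau_below[OF t, of i j] d c[of "(i, j)"] by auto
  qed
  then show "?F \<in> tableaux m L mu"
    using c \<open>m < L\<close> by (auto simp: tableaux_def dom code less_imp_le)
  show "{c\<in>mu. m < code ?F c} = la"
    using c sub by (auto simp: code split: if_splits)
  show "?F |` la = P"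
  proof
    fix x show "(?F |` la) x = P x"
      using d by (cases "P x") (auto simp: fill_rest_def restrict_map_def)
  qed
qed

section \<open>Weights of tableaux as super Schur functions\<close>

definition letter :: "'k::field \<Rightarrow> nat \<Rightarrow> bool \<times> 'k fps" where
  "letter a t = (even t, fps_const (if even t then a else 1) * fps_X ^ (t div 2))"

definition filling_weight :: "'k::field \<Rightarrow> filling \<Rightarrow> 'k fps" where
  "filling_weight a P = (\<Prod>c\<in>dom P. snd (letter a (code P c)))"

lemma filling_weight_eq:
  assumes "finite (dom P)"
  shows "filling_weight a P = fps_const (a ^ num_overlined P) * fps_X ^ weight P"
proof -
  have "filling_weight a P = (\<Prod>c\<in>dom P. fps_const (if overlined P c then a else 1)) * fps_X ^ weight P"
    by (simp add: filling_weight_def letter_def even_code code_div_2 prod.distrib weight_def power_sum)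
  also have "(\<Prod>c\<in>dom P. fps_const (if overlined P c then a else 1)) =
      (\<Prod>c\<in>dom P. if overlined P c then fps_const a else 1)"
    by (rule prod.cong) auto
  also have "\<dots> = (\<Prod>c\<in>{c\<in>dom P. overlined P c}. fps_const a)"
    by (rule prod.inter_filter[OF assms, symmetric])
  also have "\<dots> = fps_const (a ^ num_overlined P)"
    by (simp add: num_overlined_def fps_const_power)
  finally show ?thesis .
qed

text \<open>Downward induction on \<open>m\<close>: the strip of code \<open>m\<close> is the
  outermost one, and its letter is the head of the list, so peeling it off follows the recursion of
  \<open>super_schur\<close>.\<close>

lemma sum_tableaux:
  assumes "m \<le> L" "young mu"
  shows "finite (tableaux m L mu) \<and>
    (\<Sum>P\<in>tableaux m L mu. filling_weight a P) = super_schur (map (letter a) [m..<L]) mu"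
  using assms
proof (induction m arbitrary: mu rule: inc_induct)
  case base
  show ?case
  proof (cases "mu = {}")
    case True
    have "tableau Map.empty" by (simp add: tableau_def young_def)
    then have "tableaux L L mu = {Map.empty}" using True by (auto simp: tableaux_def)
    then show ?thesis using True by (simp add: filling_weight_def)
  next
    case False
    then have "tableaux L L mu = {}" by (auto simp: tableaux_def)
    then show ?thesis using False by simp
  qed
next
  case (step m)
  define A where "A = {la. young la \<and> strip (even m) la mu}"
  define f where "f = (\<lambda>(la :: (nat \<times> nat) set, P). fill_rest m mu P)"
  have bij: "bij_betw f (Sigma A (tableaux (Suc m) L)) (tableaux m L mu)"
  proof (rule bij_betw_byWitness[where f' = "\<lambda>P. ({c\<in>mu. m < code P c}, P |` {c\<in>mu. m < code P c})"])
    show "\<forall>p\<in>Sigma A (tableaux (Suc m) L). ({c\<in>mu. m < code (f p) c}, f p |` {c\<in>mu. m < code (f p) c}) = p"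
      using fill_rest_tableaux[OF step.prems \<open>m < L\<close>] by (auto simp: A_def f_def)
    show "\<forall>P\<in>tableaux m L mu. f ({c\<in>mu. m < code P c}, P |` {c\<in>mu. m < code P c}) = P"
      using restrict_tableaux by (auto simp: f_def)
    show "f ` Sigma A (tableaux (Suc m) L) \<subseteq> tableaux m L mu"
      using fill_rest_tableaux[OF step.prems \<open>m < L\<close>] by (auto simp: A_def f_def)
    show "(\<lambda>P. ({c\<in>mu. m < code P c}, P |` {c\<in>mu. m < code P c})) ` tableaux m L mu
        \<subseteq> Sigma A (tableaux (Suc m) L)"
      using restrict_tableaux by (auto simp: A_def)
  qed
  have finA: "finite A" unfolding A_def by (rule finite_subdiagrams[OF step.prems])
  have IH: "finite (tableaux (Suc m) L la)"
    "(\<Sum>P\<in>tableaux (Suc m) L la. filling_weight a P) = super_schur (map (letter a) [Suc m..<L]) la"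
    if "la \<in> A" for la
    using step.IH[of la] that by (auto simp: A_def)
  have wt: "filling_weight a (f (la, P)) = snd (letter a m) ^ (card mu - card la) * filling_weight a P"
    if "la \<in> A" "P \<in> tableaux (Suc m) L la" for la P
  proof -
    have la: "la \<subseteq> mu" "finite mu" "finite la" "dom P = la"
      using that step.prems by (auto simp: A_def tableaux_def young_finite dest: strip_subset)
    have "filling_weight a (f (la, P)) = (\<Prod>c\<in>mu. snd (letter a (code (fill_rest m mu P) c)))"
      using dom_fill_rest[where P = P and mu = mu] la by (simp add: f_def filling_weight_def)
    also have "\<dots> = (\<Prod>c\<in>mu - la. snd (letter a (code (fill_rest m mu P) c))) *
        (\<Prod>c\<in>la. snd (letter a (code (fill_rest m mu P) c)))"
      by (rule prod.subset_diff) (use la in auto)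
    also have "(\<Prod>c\<in>mu - la. snd (letter a (code (fill_rest m mu P) c))) = (\<Prod>c\<in>mu - la. snd (letter a m))"
      by (rule prod.cong) (use la in \<open>auto simp: code_fill_rest\<close>)
    also have "(\<Prod>c\<in>la. snd (letter a (code (fill_rest m mu P) c))) = filling_weight a P"
      unfolding filling_weight_def la by (rule prod.cong) (use la in \<open>auto simp: code_fill_rest\<close>)
    finally show ?thesis using la by (simp add: card_Diff_subset)
  qed
  have "(\<Sum>P\<in>tableaux m L mu. filling_weight a P) =
      (\<Sum>p\<in>Sigma A (tableaux (Suc m) L). filling_weight a (f p))"
    by (rule sum.reindex_bij_betw[OF bij, symmetric])
  also have "\<dots> = (\<Sum>la\<in>A. \<Sum>P\<in>tableaux (Suc m) L la. filling_weight a (f (la, P)))"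
    by (subst sum.Sigma) (use finA IH(1) in auto)
  also have "\<dots> = (\<Sum>la\<in>A. snd (letter a m) ^ (card mu - card la) * super_schur (map (letter a) [Suc m..<L]) la)"
    by (rule sum.cong) (simp_all add: wt IH(2) flip: sum_distrib_left)
  also have "\<dots> = super_schur (map (letter a) [m..<L]) mu"
    using \<open>m < L\<close> by (simp add: upt_conv_Cons A_def letter_def)
  finally show ?case
    using bij_betw_finite[OF bij] finA IH(1) by auto
qed

lemma has_sum_plane_overpartitions:
  fixes a :: "'k::field"
  shows "((\<lambda>P. fps_const (a ^ num_overlined P) * fps_X ^ weight P) has_sum
    super_schur_total (map (letter a) [2..<2 * n + 2])) (plane_overpartitions_upto n)"
proof -
  \<comment> \<open>The values 1 to \<open>n\<close> have the codes 2 to \<open>2 * n + 1\<close>.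
    Starting at 2 excludes the value 0, whose letters would carry no power of
    \<open>fps_X\<close>.\<close>
  let ?L = "2 * n + 2"
  have letter: "fps_X dvd snd (letter a t)" if "2 \<le> t" for t
    using that by (auto simp: letter_def intro!: dvd_mult dvd_power)
  then have ts: "\<forall>t\<in>set (map (letter a) [2..<?L]). fps_X dvd snd t"
    unfolding set_map set_upt by auto
  have wt: "fps_X ^ card mu dvd filling_weight a P" if "P \<in> tableaux 2 ?L mu" for mu P
  proof -
    have "(\<Prod>c\<in>mu. fps_X) dvd (\<Prod>c\<in>mu. snd (letter a (code P c)))"
    proof (rule prod_dvd_prod)
      fix c assume "c \<in> mu"
      then show "fps_X dvd snd (letter a (code P c))"
        using that by (intro letter) (auto simp: tableaux_def)
    qed
    moreover have "dom P = mu" using that by (simp add: tableaux_def)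
    ultimately show ?thesis by (simp add: filling_weight_def)
  qed
  have "(\<lambda>(mu, P). filling_weight a P) summable_on Sigma {mu. young mu} (tableaux 2 ?L)"
    by (rule summable_on_young_pairs[where c = 0]) (use sum_tableaux[of 2 ?L] wt in auto)
  then obtain S where S: "((\<lambda>(mu, P). filling_weight a P) has_sum S) (Sigma {mu. young mu} (tableaux 2 ?L))"
    by (auto simp: summable_on_def)
  have "(super_schur (map (letter a) [2..<?L]) has_sum S) {mu. young mu}"
  proof (rule has_sum_fps_Sigma[OF S])
    fix mu assume "mu \<in> {mu. young mu}"
    then have *: "finite (tableaux 2 ?L mu)"
      "(\<Sum>P\<in>tableaux 2 ?L mu. filling_weight a P) = super_schur (map (letter a) [2..<?L]) mu"
      using sum_tableaux[of 2 ?L mu a] by auto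
    show "((\<lambda>P. case (mu, P) of (mu, P) \<Rightarrow> filling_weight a P) has_sum super_schur (map (letter a) [2..<?L]) mu)
        (tableaux 2 ?L mu)"
      using has_sum_finite[OF *(1), of "filling_weight a"] unfolding *(2) by simp
  qed
  then have "S = super_schur_total (map (letter a) [2..<?L])"
    by (rule has_sum_fps_unique[OF _ has_sum_super_schur[OF ts]])
  moreover have "bij_betw snd (Sigma {mu. young mu} (tableaux 2 ?L)) (plane_overpartitions_upto n)"
  proof (rule bij_betw_byWitness[where f' = "\<lambda>P. (dom P, P)"])
    have "2 \<le> code P c \<and> code P c < ?L \<longleftrightarrow> 0 < entry P c \<and> entry P c \<le> n" for P c
      by (auto simp: code_def)
    then have eq: "P \<in> plane_overpartitions_upto n \<longleftrightarrow> P \<in> tableaux 2 ?L (dom P)" for P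
      by (simp only: plane_overpartitions_upto_def plane_overpartition_iff_tableau tableaux_def mem_Collect_eq) blast
    show "snd ` Sigma {mu. young mu} (tableaux 2 ?L) \<subseteq> plane_overpartitions_upto n"
    proof
      fix P assume "P \<in> snd ` Sigma {mu. young mu} (tableaux 2 ?L)"
      then obtain mu where P: "P \<in> tableaux 2 ?L mu" by auto
      then have "dom P = mu" by (simp add: tableaux_def)
      with P show "P \<in> plane_overpartitions_upto n" using eq by simp
    qed
    show "(\<lambda>P. (dom P, P)) ` plane_overpartitions_upto n \<subseteq> Sigma {mu. young mu} (tableaux 2 ?L)"
    proof
      fix p assume "p \<in> (\<lambda>P. (dom P, P)) ` plane_overpartitions_upto n"
      then obtain P where p: "p = (dom P, P)" and P: "P \<in> tableaux 2 ?L (dom P)" using eq by auto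
      then have "young (dom P)" using tableau_young by (auto simp: tableaux_def)
      with P p show "p \<in> Sigma {mu. young mu} (tableaux 2 ?L)" by simp
    qed
  qed (auto simp: tableaux_def)
  ultimately have "(filling_weight a has_sum super_schur_total (map (letter a) [2..<?L])) (plane_overpartitions_upto n)"
    using S by (simp add: has_sum_reindex_bij_betw[symmetric] case_prod_unfold)
  then show ?thesis
    by (rule has_sum_cong[THEN iffD1, rotated])
       (auto simp: filling_weight_eq plane_overpartitions_upto_def plane_overpartition_iff_tableau
          dest!: tableau_young young_finite)
qed

subsection \<open>The product formula\<close>

text \<open>The recursion of \<open>super_schur_total\<close> splits off the smallest code, whereas
  increasing \<open>n\<close> appends letters at the end. Every pair of letters is counted once, so
  the last letter can be split off just as well.\<close>

lemma super_schur_total_snoc: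
  "super_schur_total (ts @ [(w, y)]) =
    super_schur_total ts * inverse (1 - y) * (\<Prod>(v, x)\<leftarrow>ts. strip_factor v w x y)"
proof (induction ts)
  case (Cons t ts)
  obtain v x where "t = (v, x)" by force
  with Cons show ?case by (simp add: mult_ac)
qed simp

lemma upt_letters: "[2..<2 * Suc n + 2] = [2..<2 * n + 2] @ [2 * n + 2, 2 * n + 3]"
  by (simp add: upt_Suc numeral_eq_Suc)

lemma prod_list_letters:
  "prod_list (map f (map (letter a) [2..<2 * n + 2])) =
    (\<Prod>k=1..n. f (True, fps_const a * fps_X ^ k) * f (False, fps_X ^ k) :: 'b::comm_monoid_mult)"
proof (induction n)
  case (Suc n)
  then show ?case
    unfolding upt_letters by (simp add: letter_def mult_ac)
qed simp

text \<open>The two new letters contribute their own factors and the factor of their pair. With the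
  two letters of each \<open>k <= n\<close> they form four pairs; the two mixed ones give the
  square.\<close>

lemma super_schur_total_step:
  fixes a :: "'k::field" and n :: nat
  defines "N \<equiv> Suc n"
  shows "super_schur_total (map (letter a) [2..<2 * N + 2]) =
    super_schur_total (map (letter a) [2..<2 * n + 2]) *
      (inverse (1 - fps_const a * fps_X ^ N) * inverse (1 - fps_X ^ N) * (1 + fps_const a * fps_X ^ (N + N))) *
      (\<Prod>k=1..n. (1 + fps_const a * fps_X ^ (k + N))\<^sup>2 *
        (inverse (1 - fps_X ^ (k + N)) * inverse (1 - fps_const (a\<^sup>2) * fps_X ^ (k + N))))"
proof -
  let ?ts = "map (letter a) [2..<2 * n + 2]"
  have ext: "map (letter a) [2..<2 * N + 2] =
      (?ts @ [(True, fps_const a * fps_X ^ N)]) @ [(False, fps_X ^ N)]"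
    unfolding N_def upt_letters by (simp add: letter_def)
  have fa: "(fps_const a * fps_X ^ k) * (fps_const a * fps_X ^ N) = fps_const (a\<^sup>2) * fps_X ^ (k + N)" for k
    by (simp add: power_add power2_eq_square mult_ac flip: fps_const_mult)
  have sf:
    "strip_factor True True (fps_const a * fps_X ^ k) (fps_const a * fps_X ^ N) =
      inverse (1 - fps_const (a\<^sup>2) * fps_X ^ (k + N))"
    "strip_factor False True (fps_X ^ k) (fps_const a * fps_X ^ N) = 1 + fps_const a * fps_X ^ (k + N)"
    "strip_factor True False (fps_const a * fps_X ^ k) (fps_X ^ N) = 1 + fps_const a * fps_X ^ (k + N)"
    "strip_factor False False (fps_X ^ k) (fps_X ^ N) = (inverse (1 - fps_X ^ (k + N)) :: 'k fps)" for k
    unfolding strip_factor_def fa by (simp_all add: power_add mult_ac)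
  have "super_schur_total (map (letter a) [2..<2 * N + 2]) =
      super_schur_total ?ts * inverse (1 - fps_const a * fps_X ^ N) *
        (\<Prod>k=1..n. inverse (1 - fps_const (a\<^sup>2) * fps_X ^ (k + N)) * (1 + fps_const a * fps_X ^ (k + N))) *
      inverse (1 - fps_X ^ N) *
        ((\<Prod>k=1..n. (1 + fps_const a * fps_X ^ (k + N)) * inverse (1 - fps_X ^ (k + N))) *
          (1 + fps_const a * fps_X ^ (N + N)))"
    unfolding ext super_schur_total_snoc map_append prod_list.append prod_list_letters
    by (simp only: list.map prod_list.Cons prod_list.Nil prod.case sf mult_1_right)
  then show ?thesis
    by (simp add: prod.distrib power2_eq_square mult_ac)
qed

lemma inverse_prod_fps:
  fixes f :: "'a \<Rightarrow> 'k::field fps"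
  shows "inverse (\<Prod>i\<in>A. f i) = (\<Prod>i\<in>A. inverse (f i))"
  by (induction A rule: infinite_finite_induct) (auto simp: fps_inverse_mult)

lemma fps_prod_nth_0:
  fixes f :: "'a \<Rightarrow> 'k::comm_ring_1 fps"
  shows "(\<Prod>i\<in>A. f i) $ 0 = (\<Prod>i\<in>A. f i $ 0)"
  by (induction A rule: infinite_finite_induct) simp_all

text \<open>Increasing \<open>n\<close> also raises the bound of \<open>i\<close> for the old
  \<open>j\<close>, which yields one copy of \<open>U\<close>; the new \<open>j = N\<close> yields
  the other. Together they match the squares in \<open>super_schur_total_step\<close>.\<close>

lemma super_schur_total_eq:
  fixes a :: "'k::field"
  shows "super_schur_total (map (letter a) [2..<2 * n + 2]) =
    (\<Prod>j=1..n. (\<Prod>i=0..n. 1 + fps_const a * fps_X ^ (i + j)) *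
      (\<Prod>i=1..j. inverse (1 - fps_X ^ (i + j - 1)) * inverse (1 - fps_const (a\<^sup>2) * fps_X ^ (i + j))))"
    (is "_ = ?R n")
proof (induction n)
  case (Suc n)
  define N where "N = Suc n"
  define u where "u k = 1 + fps_const a * fps_X ^ k" for k
  define p where "p k = inverse (1 - fps_X ^ k :: 'k fps)" for k
  define r where "r k = inverse (1 - fps_const (a\<^sup>2) * fps_X ^ k)" for k
  define U where "U = (\<Prod>k=1..n. u (k + N))"
  define B where "B j = (\<Prod>i=1..j. p (i + j - 1) * r (i + j))" for j
  have u0: "u k $ 0 = 1" if "k > 0" for k
    using that by (simp add: u_def)
  have "?R N = (\<Prod>j=1..N. (\<Prod>i=0..N. u (i + j)) * B j)"
    by (simp add: u_def p_def r_def B_def)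
  also have "\<dots> = (\<Prod>j=1..n. (\<Prod>i=0..N. u (i + j)) * B j) * ((\<Prod>i=0..N. u (i + N)) * B N)"
    by (simp add: N_def)
  also have "(\<Prod>j=1..n. (\<Prod>i=0..N. u (i + j)) * B j) =
      (\<Prod>j=1..n. (\<Prod>i=0..n. u (i + j)) * B j) * U"
    by (simp add: N_def U_def prod.distrib mult_ac add_ac)
  also have "(\<Prod>j=1..n. (\<Prod>i=0..n. u (i + j)) * B j) = ?R n"
    by (simp add: u_def p_def r_def B_def)
  also have "(\<Prod>i=0..N. u (i + N)) = u N * U * u (N + N)"
    by (simp add: N_def U_def prod.atLeast_Suc_atMost[of 0] mult_ac flip: One_nat_def)
  \<comment> \<open>The exponents \<open>i + N - 1\<close> begin with \<open>N\<close>, which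
    belongs to the single letter \<open>q^N\<close>, while the exponents \<open>i + N\<close> end
    with \<open>N + N\<close>, which belongs to no pair of distinct letters of equal type.\<close>
  also have "B N = p N * (\<Prod>k=1..n. p (k + N)) * ((\<Prod>k=1..n. r (k + N)) * r (N + N))"
  proof -
    have "(\<Prod>i=1..N. p (i + N - 1)) = p N * (\<Prod>i=Suc 1..Suc n. p (i + N - 1))"
      unfolding N_def by (subst prod.atLeast_Suc_atMost) auto
    also have "(\<Prod>i=Suc 1..Suc n. p (i + N - 1)) = (\<Prod>k=1..n. p (k + N))"
      by (subst prod.shift_bounds_cl_Suc_ivl) simp
    finally show ?thesis
      by (simp add: B_def prod.distrib N_def)
  qed
  \<comment> \<open>A difference of squares: one factor belongs to the letter \<open>a q^N\<close>,
    the other will cancel the factor \<open>u N\<close> coming from \<open>i = 0\<close>.\<close>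
  also have "r (N + N) = inverse (1 - fps_const a * fps_X ^ N) * inverse (u N)"
  proof -
    have "1 - fps_const (a\<^sup>2) * fps_X ^ (N + N) = (1 - fps_const a * fps_X ^ N) * u N"
      by (simp add: u_def power_add power2_eq_square algebra_simps flip: fps_const_mult)
    then show ?thesis by (simp add: r_def fps_inverse_mult)
  qed
  finally have R: "?R N = ?R n * U * (u N * U * u (N + N) *
      (p N * (\<Prod>k=1..n. p (k + N)) * ((\<Prod>k=1..n. r (k + N)) *
      (inverse (1 - fps_const a * fps_X ^ N) * inverse (u N)))))" .
  have "?R N = (inverse (u N) * u N) * (?R n * (inverse (1 - fps_const a * fps_X ^ N) * p N * u (N + N)) *
      (U * U * ((\<Prod>k=1..n. p (k + N)) * (\<Prod>k=1..n. r (k + N)))))"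
    unfolding R by (simp only: mult_ac)
  also have "inverse (u N) * u N = 1"
    by (rule inverse_mult_eq_1) (simp add: u0 N_def)
  also have "1 * (?R n * (inverse (1 - fps_const a * fps_X ^ N) * p N * u (N + N)) *
      (U * U * ((\<Prod>k=1..n. p (k + N)) * (\<Prod>k=1..n. r (k + N))))) =
      super_schur_total (map (letter a) [2..<2 * N + 2])"
    unfolding super_schur_total_step[of a n, folded N_def] Suc.IH
    by (simp add: U_def u_def p_def r_def prod.distrib power2_eq_square)
  finally show ?case by (simp add: N_def)
qed simp

theorem theorem6:
  fixes a :: "'k::field" and n :: nat
  assumes "n \<ge> 1"
  shows "((\<lambda>P. fps_const (a ^ num_overlined P) * fps_X ^ weight P) has_sum
      (\<Prod>j=1..n. (\<Prod>i=0..n. 1 + fps_const a * fps_X ^ (i + j)) /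
         (\<Prod>i=1..j. (1 - fps_X ^ (i + j - 1)) * (1 - fps_const (a\<^sup>2) * fps_X ^ (i + j)))))
      (plane_overpartitions_upto n)"
proof -
  have "(\<Prod>i=0..n. 1 + fps_const a * fps_X ^ (i + j)) /
         (\<Prod>i=1..j. (1 - fps_X ^ (i + j - 1)) * (1 - fps_const (a\<^sup>2) * fps_X ^ (i + j))) =
      (\<Prod>i=0..n. 1 + fps_const a * fps_X ^ (i + j)) *
      (\<Prod>i=1..j. inverse (1 - fps_X ^ (i + j - 1)) * inverse (1 - fps_const (a\<^sup>2) * fps_X ^ (i + j)))"
    if "j \<in> {1..n}" for j
  proof -
    \<comment> \<open>All exponents are positive as \<open>i\<close> and \<open>j\<close> are at
      least 1, so the denominator has constant term 1 and division is multiplication by its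
      inverse.\<close>
    have "(\<Prod>i=1..j. (1 - fps_X ^ (i + j - 1)) * (1 - fps_const (a\<^sup>2) * fps_X ^ (i + j))) $ 0 =
        (\<Prod>i=1..j. ((1 - fps_X ^ (i + j - 1)) * (1 - fps_const (a\<^sup>2) * fps_X ^ (i + j))) $ 0)"
      by (rule fps_prod_nth_0)
    also have "\<dots> = 1"
      using that by (intro prod.neutral) auto
    finally show ?thesis
      by (simp only: fps_divide_unit inverse_prod_fps fps_inverse_mult one_neq_zero not_False_eq_True)
  qed
  then show ?thesis
    using has_sum_plane_overpartitions[of a n] unfolding super_schur_total_eq by simp
qed

end
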